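(* Let $G=(V,q)$ be a reversible connected graph with invariant measure $m$ satisfying $CD(0,\infty)$, and suppose that one of the following holds: (A) $\sup_{x\in V}\sum_{y\ne x}q(x,y)<\infty$; (B) $\inf_{x\in V}m(x)>0$ and there exist finitely supported $\eta_k:V\to\mathbb R$ with $\Gamma\eta_k\le 1/k$ and $\eta_k\to1$ pointwise from below; (C) $q(x,y)\le m(y)$ for all $x,y\in V$. Then for every non-negative finitely supported $f:V\to\mathbb R$ and every $t>0$, \[ \|\nabla P_tf\|_\infty\le\frac{\|f\|_\infty}{\sqrt{t\,q_{\min}}}. \] If (A) or (B) holds, this inequality holds for all $f\in\ell_\infty(V)$.
   Context: A graph $G=(V,q)$ consists of a countable set $V$ and a function $q:V\times V\to[0,\infty)$ such that $\#\{y:q(x,y)>0\}<\infty$ for every $x\in V$; its Laplacian is $\Delta f(x)=\sum_y q(x,y)(f(y)-f(x))$. Reversible with invariant measure $m:V\to(0,\infty)$: $q(x,y)m(x)=q(y,x)m(y)$. $d$ is the combinatorial graph distance ($x\sim y$ iff $q(x,y)>0$). $q_{\min}:=\inf\{q(x,y):q(x,y)>0\}$. For $x\ne y$, $\nabla_{xy}f=(f(x)-f(y))/d(x,y)$, $\|\nabla f\|_\infty=\sup_{x\ne y}|\nabla_{xy}f|$. Bakry–Émery: $\Gamma_0(f,g)=fg$, $2\Gamma_{k+1}(f,g)=\Delta\Gamma_k(f,g)-\Gamma_k(f,\Delta g)-\Gamma_k(\Delta f,g)$, $\Gamma=\Gamma_1$, $\Gamma_kf=\Gamma_k(f,f)$;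 $G$ satisfies $CD(0,\infty)$ if $\Gamma_2f\ge0$ for all $f:V\to\mathbb R$. Heat semigroup: for finite $S$ let $q_S(x,y)=q(x,y)1_S(x)$ with Laplacian $\Delta_S$ and $P^S_tf=\sum_{k\ge0}t^k\Delta_S^k(f1_S)/k!$; for bounded $f$, $P_tf=\lim_iP_t^{S_i}f$ pointwise along any increasing exhaustion by finite sets. *)

theory Defs
  imports "HOL-Analysis.Analysis" "HOL-Library.Countable"
begin

(* A graph on the (countable) vertex type 'v: q is non-negative and locally finite. *)
definition is_graph :: "('v \<Rightarrow> 'v \<Rightarrow> real) \<Rightarrow> bool" where
  "is_graph q \<longleftrightarrow> (\<forall>x y. q x y \<ge> 0) \<and> (\<forall>x. finite {y. q x y > 0})"

(* Laplacian  \<Delta> f x = \<Sum>_y q(x,y) (f y - f x)  (sum over the finitely many neighbours) *)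
definition laplacian :: "('v \<Rightarrow> 'v \<Rightarrow> real) \<Rightarrow> ('v \<Rightarrow> real) \<Rightarrow> 'v \<Rightarrow> real" where
  "laplacian q f x = (\<Sum>y\<in>{y. q x y > 0}. q x y * (f y - f x))"

definition reversible :: "('v \<Rightarrow> 'v \<Rightarrow> real) \<Rightarrow> ('v \<Rightarrow> real) \<Rightarrow> bool" where
  "reversible q m \<longleftrightarrow> (\<forall>x. m x > 0) \<and> (\<forall>x y. q x y * m x = q y x * m y)"

(* adjacency relation: x ~ y iff q(x,y) > 0 *)
definition adj :: "('v \<Rightarrow> 'v \<Rightarrow> real) \<Rightarrow> ('v \<times> 'v) set" where
  "adj q = {(x, y). q x y > 0}"

definition connected_graph :: "('v \<Rightarrow> 'v \<Rightarrow> real) \<Rightarrow> bool" where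
  "connected_graph q \<longleftrightarrow> (\<forall>x y. (x, y) \<in> (adj q)\<^sup>*)"

(* combinatorial graph distance *)
definition graph_dist :: "('v \<Rightarrow> 'v \<Rightarrow> real) \<Rightarrow> 'v \<Rightarrow> 'v \<Rightarrow> nat" where
  "graph_dist q x y = (LEAST n. (x, y) \<in> (adj q) ^^ n)"

definition q_min :: "('v \<Rightarrow> 'v \<Rightarrow> real) \<Rightarrow> real" where
  "q_min q = Inf {q x y | x y. q x y > 0}"

(* \<nabla>_{xy} f *)
definition grad :: "('v \<Rightarrow> 'v \<Rightarrow> real) \<Rightarrow> ('v \<Rightarrow> real) \<Rightarrow> 'v \<Rightarrow> 'v \<Rightarrow> real" where
  "grad q f x y = (f x - f y) / real (graph_dist q x y)"

definition sup_norm :: "('v \<Rightarrow> real) \<Rightarrow> real" where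
  "sup_norm f = Sup (range (\<lambda>x. \<bar>f x\<bar>))"

definition bounded_fun :: "('v \<Rightarrow> real) \<Rightarrow> bool" where
  "bounded_fun f \<longleftrightarrow> bdd_above (range (\<lambda>x. \<bar>f x\<bar>))"

definition fin_supp :: "('v \<Rightarrow> real) \<Rightarrow> bool" where
  "fin_supp f \<longleftrightarrow> finite {x. f x \<noteq> 0}"

(* Bakry-Emery operators \<Gamma>_k(f,g) *)
primrec Gamma_k :: "('v \<Rightarrow> 'v \<Rightarrow> real) \<Rightarrow> nat \<Rightarrow> ('v \<Rightarrow> real) \<Rightarrow> ('v \<Rightarrow> real) \<Rightarrow> 'v \<Rightarrow> real" where
  "Gamma_k q 0 f g = (\<lambda>x. f x * g x)"
| "Gamma_k q (Suc k) f g = (\<lambda>x. (laplacian q (Gamma_k q k f g) x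
      - Gamma_k q k f (laplacian q g) x - Gamma_k q k (laplacian q f) g x) / 2)"

definition Gamma :: "('v \<Rightarrow> 'v \<Rightarrow> real) \<Rightarrow> ('v \<Rightarrow> real) \<Rightarrow> 'v \<Rightarrow> real" where
  "Gamma q f = Gamma_k q 1 f f"

definition CD0inf :: "('v \<Rightarrow> 'v \<Rightarrow> real) \<Rightarrow> bool" where
  "CD0inf q \<longleftrightarrow> (\<forall>f x. Gamma_k q 2 f f x \<ge> 0)"

(* Dirichlet heat semigroup on a finite set S: q_S(x,y) = q(x,y) 1_S(x) *)
definition q_restr :: "('v \<Rightarrow> 'v \<Rightarrow> real) \<Rightarrow> 'v set \<Rightarrow> 'v \<Rightarrow> 'v \<Rightarrow> real" where
  "q_restr q S x y = q x y * indicator S x"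

definition heat_fin :: "('v \<Rightarrow> 'v \<Rightarrow> real) \<Rightarrow> 'v set \<Rightarrow> real \<Rightarrow> ('v \<Rightarrow> real) \<Rightarrow> 'v \<Rightarrow> real" where
  "heat_fin q S t f x =
     (\<Sum>k. t ^ k / fact k * ((laplacian (q_restr q S)) ^^ k) (\<lambda>z. f z * indicator S z) x)"

definition exhaustion :: "(nat \<Rightarrow> 'v set) \<Rightarrow> bool" where
  "exhaustion S \<longleftrightarrow> (\<forall>i. finite (S i)) \<and> incseq S \<and> (\<Union>i. S i) = UNIV"

(* P_t f x = lim_i P^{S_i}_t f x along any increasing exhaustion by finite sets *)
definition heat :: "('v \<Rightarrow> 'v \<Rightarrow> real) \<Rightarrow> real \<Rightarrow> ('v \<Rightarrow> real) \<Rightarrow> 'v \<Rightarrow> real" where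
  "heat q t f x = (THE L. \<forall>S. exhaustion S \<longrightarrow> (\<lambda>i. heat_fin q (S i) t f x) \<longlonglongrightarrow> L)"

end

theory Submission
  imports Defs
begin

text \<open>
  For finitely supported \<open>f\<close> with \<open>\<bar>f\<bar> \<le> c\<close> and \<open>u\<^sub>s = P\<^sub>s f\<close>, \<open>CD(0,\<infinity>)\<close> makes \<open>H\<^sub>s = 2 s \<Gamma>(u\<^sub>s) + u\<^sub>s\<^sup>2\<close> a
  subsolution of the heat equation with \<open>H\<^sub>0 \<le> c\<^sup>2\<close>. Testing the equation for \<open>W = H - c\<^sup>2\<close> against \<open>\<eta>\<^sup>2 W\<^sub>+\<close>
  with a finitely supported cutoff \<open>\<eta>\<close> bounds the time derivative of the weighted \<open>l\<^sup>2\<close> norm of \<open>\<eta> W\<^sub>+\<close> by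
  \<open>\<Sum> m(x) q(x,y) W\<^sub>+(x) W\<^sub>+(y) (\<eta>(x) - \<eta>(y))\<^sup>2\<close>. Energy estimates bound \<open>H\<close> in \<open>l\<^sup>1(m)\<close>, so this error
  tends to 0: under (B) along the given cutoffs, because \<open>H\<close> is then bounded; under (A) and (C) for
  \<open>\<eta> = (1 - d(x,\<cdot>)/N)\<^sub>+\<close>, because \<open>\<Sum> q(x,y) H(y)\<close> over \<open>y \<noteq> x\<close> is bounded. Hence \<open>H \<le> c\<^sup>2\<close>, and a single
  term of \<open>2 t \<Gamma>(u\<^sub>t) \<le> c\<^sup>2\<close> is the gradient bound along an edge. Bounded functions are limits of
  their truncations.
\<close>

section \<open>Calculus and limits along finite sets\<close>

text \<open>A quadratic remainder estimate is an inequality between values, so it survives pointwise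
  limits, which differentiability alone does not. It also copes with the kink of the squared
  positive part.\<close>

lemma has_real_derivative_quadratic_bound:
  fixes f :: "real \<Rightarrow> real"
  assumes "\<And>y. y \<in> A \<Longrightarrow> \<bar>f y - f x - D * (y - x)\<bar> \<le> K * (y - x)\<^sup>2"
  shows "(f has_real_derivative D) (at x within A)"
proof -
  have "((\<lambda>y. (f y - f x) / (y - x) - D) \<longlongrightarrow> 0) (at x within A)"
  proof (rule Lim_null_comparison)
    show "\<forall>\<^sub>F y in at x within A. norm ((f y - f x) / (y - x) - D) \<le> K * \<bar>y - x\<bar>"
      unfolding eventually_at_filter
    proof (intro always_eventually allI impI)
      fix y assume "y \<noteq> x" "y \<in> A"
      then have "\<bar>(f y - f x) / (y - x) - D\<bar> = \<bar>f y - f x - D * (y - x)\<bar> / \<bar>y - x\<bar>"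
        by (simp add: diff_divide_distrib flip: abs_divide)
      also have "\<dots> \<le> K * (y - x)\<^sup>2 / \<bar>y - x\<bar>"
        using assms[OF \<open>y \<in> A\<close>] by (intro divide_right_mono) auto
      also have "\<dots> = K * \<bar>y - x\<bar>"
        using \<open>y \<noteq> x\<close> by (subst power2_abs[symmetric]) (simp add: power2_eq_square del: abs_mult_self_eq)
      finally show "norm ((f y - f x) / (y - x) - D) \<le> K * \<bar>y - x\<bar>" by simp
    qed
    show "((\<lambda>y. K * \<bar>y - x\<bar>) \<longlongrightarrow> 0) (at x within A)"
      by (auto intro!: tendsto_eq_intros)
  qed
  then show ?thesis
    unfolding has_field_derivative_iff using LIM_zero_iff by blast
qed

text \<open>Squaring removes the kink of the positive part to first order, so the energy of
  \<open>W\<^sub>+\<close> can be differentiated in time without regularization.\<close>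

lemma DERIV_pos_part_square:
  "((\<lambda>r::real. (max 0 r)\<^sup>2) has_real_derivative 2 * max 0 r) (at r)"
proof (rule has_real_derivative_quadratic_bound[where K = 1])
  fix y :: real
  \<comment> \<open>For \<open>y\<close> across the kink from \<open>r \<ge> 0\<close> the remainder
    is \<open>(y - r)\<^sup>2 - y\<^sup>2\<close>, which lies between 0 and
    \<open>(y - r)\<^sup>2\<close>.\<close>
  have "\<bar>r\<^sup>2 + 2 * r * (y - r)\<bar> \<le> (y - r)\<^sup>2" if "r \<ge> 0" "y \<le> 0"
  proof -
    have "y\<^sup>2 \<le> (y - r)\<^sup>2" using that by (intro abs_le_square_iff[THEN iffD1]) auto
    moreover have "r\<^sup>2 + 2 * r * (y - r) = y\<^sup>2 - (y - r)\<^sup>2" by (simp add: power2_eq_square algebra_simps)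
    ultimately show ?thesis by (simp add: abs_if)
  qed
  moreover have "y\<^sup>2 \<le> (y - r)\<^sup>2" if "r \<le> 0" "y \<ge> 0"
    using that by (intro abs_le_square_iff[THEN iffD1]) auto
  moreover have "y\<^sup>2 - r\<^sup>2 - 2 * r * (y - r) = (y - r)\<^sup>2"
    by (simp add: power2_eq_square algebra_simps)
  ultimately show "\<bar>(max 0 y)\<^sup>2 - (max 0 r)\<^sup>2 - 2 * max 0 r * (y - r)\<bar> \<le> 1 * (y - r)\<^sup>2"
    by (cases "r \<ge> 0"; cases "y \<ge> 0") (auto simp: max_def abs_minus_commute)
qed

lemma tendsto_Sup_finite_subsets:
  fixes h :: "'a set \<Rightarrow> real"
  assumes bound: "\<And>S. finite S \<Longrightarrow> h S \<le> c"
    and mono: "\<And>S S'. finite S' \<Longrightarrow> S \<subseteq> S' \<Longrightarrow> h S \<le> h S'"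
  shows "\<exists>L. (h \<longlongrightarrow> L) (finite_subsets_at_top UNIV)"
proof
  have bdd: "bdd_above (h ` {S. finite S})"
    using bound by (auto intro!: bdd_aboveI)
  show "(h \<longlongrightarrow> (SUP S\<in>{S. finite S}. h S)) (finite_subsets_at_top UNIV)"
  proof (rule order_tendstoI)
    fix a assume "a < (SUP S\<in>{S. finite S}. h S)"
    then obtain S0 where S0: "finite S0" "a < h S0"
      using less_cSUP_iff[of "{S. finite S}" h a] bdd by auto
    then have "\<forall>S. finite S \<and> S0 \<subseteq> S \<and> S \<subseteq> UNIV \<longrightarrow> a < h S"
      using mono less_le_trans by blast
    then show "eventually (\<lambda>S. a < h S) (finite_subsets_at_top UNIV)"
      unfolding eventually_finite_subsets_at_top using S0 by blast
  next
    fix a assume a: "(SUP S\<in>{S. finite S}. h S) < a"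
    have "h S < a" if "finite S" for S
      using cSUP_upper[OF _ bdd, of S] that a by auto
    then show "eventually (\<lambda>S. h S < a) (finite_subsets_at_top UNIV)"
      by (intro eventually_finite_subsets_at_top_weakI)
  qed
qed

section \<open>Linearity and continuity of the Laplacian; exhaustions\<close>

lemma laplacian_cmult: "laplacian p (\<lambda>x. c * f x) x = c * laplacian p f x"
  by (simp add: laplacian_def sum_distrib_left algebra_simps)

lemma laplacian_add: "laplacian p (\<lambda>x. f x + g x) x = laplacian p f x + laplacian p g x"
  by (simp add: laplacian_def sum.distrib[symmetric] algebra_simps)

lemma laplacian_diff: "laplacian p (\<lambda>x. f x - g x) x = laplacian p f x - laplacian p g x"
  by (simp add: laplacian_def sum_subtractf[symmetric] algebra_simps)

lemma laplacian_minus_const: "laplacian p (\<lambda>x. f x - c) x = laplacian p f x"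
  by (simp add: laplacian_def)

lemma has_real_derivative_laplacian:
  assumes "\<And>y. ((\<lambda>s. W s y) has_real_derivative W' y) (at t within A)"
  shows "((\<lambda>s. laplacian p (W s) x) has_real_derivative laplacian p W' x) (at t within A)"
  unfolding laplacian_def by (intro DERIV_sum DERIV_cmult DERIV_diff assms)

lemma tendsto_laplacian:
  assumes "\<And>y. ((\<lambda>s. W s y) \<longlongrightarrow> W' y) F"
  shows "((\<lambda>s. laplacian p (W s) x) \<longlongrightarrow> laplacian p W' x) F"
  unfolding laplacian_def by (intro tendsto_intros assms)

text \<open>Countability enters here: sublevel sets of an injection into the naturals are
  finite.\<close>

lemma ex_exhaustion: "\<exists>S :: nat \<Rightarrow> 'v::countable set. exhaustion S"
proof
  let ?S = "\<lambda>i. {x :: 'v. to_nat x \<le> i}"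
  have "finite (?S i)" for i
    using finite_vimageI[of "{..i}" "to_nat :: 'v \<Rightarrow> nat"] by (simp add: vimage_def)
  then show "exhaustion ?S"
    unfolding exhaustion_def incseq_def by fastforce
qed

text \<open>An exhaustion eventually contains any given finite set. Hence one limit along the filter
  of finite sets settles the limits along all exhaustions at once, with a common value.\<close>

lemma filterlim_exhaustion:
  fixes S :: "nat \<Rightarrow> 'v set"
  assumes "exhaustion S"
  shows "filterlim S (finite_subsets_at_top UNIV) sequentially"
  unfolding filterlim_finite_subsets_at_top
proof safe
  fix X :: "'v set" assume "finite X"
  moreover have "\<forall>x\<in>X. eventually (\<lambda>i. x \<in> S i) sequentially"
  proof
    fix x
    obtain j where "x \<in> S j" using assms unfolding exhaustion_def by blast
    then show "eventually (\<lambda>i. x \<in> S i) sequentially"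
      using assms unfolding exhaustion_def incseq_def eventually_sequentially by blast
  qed
  ultimately have "eventually (\<lambda>i. \<forall>x\<in>X. x \<in> S i) sequentially"
    by (simp add: eventually_ball_finite)
  then show "eventually (\<lambda>i. finite (S i) \<and> X \<subseteq> S i \<and> S i \<subseteq> UNIV) sequentially"
    using assms by (auto simp: exhaustion_def elim!: eventually_mono)
qed

text \<open>The description operator in \<open>heat\<close> needs a unique value; uniqueness rests
  on the existence of at least one exhaustion, since otherwise every number would qualify.\<close>

lemma heat_eqI:
  fixes q :: "'v::countable \<Rightarrow> 'v \<Rightarrow> real"
  assumes "((\<lambda>S. heat_fin q S t f x) \<longlongrightarrow> L) (finite_subsets_at_top UNIV)"
  shows "heat q t f x = L"
  unfolding heat_def
proof (rule the_equality)
  show *: "\<forall>S. exhaustion S \<longrightarrow> (\<lambda>i. heat_fin q (S i) t f x) \<longlonglongrightarrow> L"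
    using filterlim_compose[OF assms filterlim_exhaustion] by blast
  fix L' assume "\<forall>S. exhaustion S \<longrightarrow> (\<lambda>i. heat_fin q (S i) t f x) \<longlonglongrightarrow> L'"
  with * show "L' = L"
    using ex_exhaustion LIMSEQ_unique by metis
qed

section \<open>Summation by parts and the maximum principle\<close>

locale reversible_graph =
  fixes q :: "'v::countable \<Rightarrow> 'v \<Rightarrow> real" and m :: "'v \<Rightarrow> real"
  assumes graph: "is_graph q" and rev: "reversible q m"
begin

abbreviation nb :: "'v \<Rightarrow> 'v set" where "nb x \<equiv> {y. q x y > 0}"

lemma q_nonneg [simp]: "q x y \<ge> 0"
  using graph by (simp add: is_graph_def)

lemma finite_nb [simp]: "finite (nb x)"
  using graph by (simp add: is_graph_def)

lemma q_zero: "\<not> q x y > 0 \<Longrightarrow> q x y = 0"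
  using q_nonneg[of x y] by linarith

lemma m_pos [simp]: "m x > 0"
  using rev by (simp add: reversible_def)

lemma m_nonneg [simp]: "m x \<ge> 0"
  using m_pos[of x] by (rule less_imp_le)

lemma detailed_balance: "m x * q x y = m y * q y x"
  using rev by (simp add: reversible_def mult.commute)

lemma nb_sym: "y \<in> nb x \<longleftrightarrow> x \<in> nb y"
proof -
  have "0 < q x y \<longleftrightarrow> 0 < m x * q x y" "0 < q y x \<longleftrightarrow> 0 < m y * q y x"
    using m_pos[of x] m_pos[of y] by (auto intro: mult_pos_pos dest: zero_less_mult_pos)
  then show ?thesis using detailed_balance[of x y] by simp
qed

text \<open>Since \<open>q\<close> vanishes off the neighbourhood, sums may run over one finite box
  \<open>B\<close> common to all vertices, where the order of summation can be exchanged.\<close>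

lemma sum_nb:
  assumes "finite B" "nb x \<subseteq> B"
  shows "(\<Sum>y\<in>nb x. q x y * g y) = (\<Sum>y\<in>B. q x y * g y)"
  using assms by (intro sum.mono_neutral_left) (auto dest: q_zero)

lemma laplacian_eq:
  assumes "finite B" "nb x \<subseteq> B"
  shows "laplacian q f x = (\<Sum>y\<in>B. q x y * (f y - f x))"
  unfolding laplacian_def by (rule sum_nb[OF assms])

lemma laplacian_restr: "laplacian (q_restr q S) f x = (if x \<in> S then laplacian q f x else 0)"
  by (simp add: laplacian_def q_restr_def)

lemma laplacian_restr_sum:
  "laplacian (q_restr q S) f x = (\<Sum>y\<in>nb x. q x y * indicator S x * (f y - f x))"
  unfolding laplacian_restr by (simp add: laplacian_def)

text \<open>Green's formula: exchange the two summation variables, use detailed balance, and average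
  with the original sum. There is no boundary term because edges leaving \<open>B\<close> are absent
  from both sides.\<close>

lemma sum_by_parts:
  fixes \<phi> \<psi> :: "'v \<Rightarrow> real"
  assumes "finite B"
  shows "2 * (\<Sum>x\<in>B. \<Sum>y\<in>B. m x * q x y * \<phi> x * (\<psi> y - \<psi> x)) =
         - (\<Sum>x\<in>B. \<Sum>y\<in>B. m x * q x y * ((\<phi> y - \<phi> x) * (\<psi> y - \<psi> x)))"
proof -
  let ?s = "\<Sum>x\<in>B. \<Sum>y\<in>B. m x * q x y * \<phi> x * (\<psi> y - \<psi> x)"
  have "?s = (\<Sum>x\<in>B. \<Sum>y\<in>B. m y * q y x * \<phi> y * (\<psi> x - \<psi> y))"
    by (subst sum.swap) simp
  also have "\<dots> = (\<Sum>x\<in>B. \<Sum>y\<in>B. m x * q x y * \<phi> y * (\<psi> x - \<psi> y))"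
    by (intro sum.cong refl arg_cong2[where f = "(*)"] detailed_balance)
  finally have "2 * ?s = ?s + (\<Sum>x\<in>B. \<Sum>y\<in>B. m x * q x y * \<phi> y * (\<psi> x - \<psi> y))" by simp
  then show ?thesis
    by (simp only: sum.distrib[symmetric] sum_negf[symmetric]) (simp add: algebra_simps)
qed

text \<open>The support of \<open>\<phi>\<close> together with its neighbours lies in
  \<open>B\<close>, so restricting the Laplacian to edges inside \<open>B\<close> loses nothing
  where \<open>\<phi>\<close> is nonzero.\<close>

lemma sum_laplacian:
  assumes "finite B" "\<And>x. \<phi> x \<noteq> 0 \<Longrightarrow> x \<in> B \<and> nb x \<subseteq> B"
  shows "(\<Sum>x\<in>B. m x * \<phi> x * laplacian q \<psi> x) =
         (\<Sum>x\<in>B. \<Sum>y\<in>B. m x * q x y * \<phi> x * (\<psi> y - \<psi> x))"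
proof (rule sum.cong[OF refl])
  fix x
  show "m x * \<phi> x * laplacian q \<psi> x = (\<Sum>y\<in>B. m x * q x y * \<phi> x * (\<psi> y - \<psi> x))"
  proof (cases "\<phi> x = 0")
    case False
    then show ?thesis
      using assms laplacian_eq[of B x \<psi>] by (simp add: sum_distrib_left algebra_simps)
  qed simp
qed

text \<open>A Caccioppoli inequality. Green's formula for \<open>(\<eta> x)\<^sup>2 * p x\<close>
  and \<open>p\<close>, with \<open>p = max 0 W\<close>, produces a square minus the error term on
  the right; the square has the favourable sign and is dropped.\<close>

lemma cutoff_energy_inequality:
  fixes \<eta> W :: "'v \<Rightarrow> real"
  assumes B: "finite B" "\<And>x. \<eta> x \<noteq> 0 \<Longrightarrow> x \<in> B \<and> nb x \<subseteq> B"
  shows "2 * (\<Sum>x\<in>B. m x * ((\<eta> x)\<^sup>2 * max 0 (W x)) * laplacian q W x) \<le>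
         (\<Sum>x\<in>B. \<Sum>y\<in>B. m x * q x y * (max 0 (W x) * max 0 (W y) * (\<eta> x - \<eta> y)\<^sup>2))"
proof -
  define p where "p x = max 0 (W x)" for x
  \<comment> \<open>Both sides vanish where \<open>W x \<le> 0\<close>; elsewhere
    \<open>p x = W x\<close>, and \<open>W y \<le> p y\<close> always.\<close>
  have p: "p x * (W y - W x) \<le> p x * (p y - p x)" for x y
    unfolding p_def by (cases "W x \<le> 0") (auto intro!: mult_left_mono)
  have "(\<Sum>x\<in>B. m x * ((\<eta> x)\<^sup>2 * p x) * laplacian q W x)
        = (\<Sum>x\<in>B. \<Sum>y\<in>B. m x * q x y * ((\<eta> x)\<^sup>2 * p x) * (W y - W x))"
    using B by (intro sum_laplacian) auto
  also have "\<dots> \<le> (\<Sum>x\<in>B. \<Sum>y\<in>B. m x * q x y * ((\<eta> x)\<^sup>2 * p x) * (p y - p x))"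
  proof (intro sum_mono)
    fix x y
    have "(m x * q x y * (\<eta> x)\<^sup>2) * (p x * (W y - W x)) \<le> (m x * q x y * (\<eta> x)\<^sup>2) * (p x * (p y - p x))"
      by (intro mult_left_mono p) auto
    then show "m x * q x y * ((\<eta> x)\<^sup>2 * p x) * (W y - W x) \<le> m x * q x y * ((\<eta> x)\<^sup>2 * p x) * (p y - p x)"
      by (simp add: algebra_simps)
  qed
  finally have "2 * (\<Sum>x\<in>B. m x * ((\<eta> x)\<^sup>2 * p x) * laplacian q W x) \<le>
     - (\<Sum>x\<in>B. \<Sum>y\<in>B. m x * q x y * (((\<eta> y)\<^sup>2 * p y - (\<eta> x)\<^sup>2 * p x) * (p y - p x)))"
    using sum_by_parts[OF B(1), of "\<lambda>x. (\<eta> x)\<^sup>2 * p x" p] by linarith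
  also have "\<dots> \<le> (\<Sum>x\<in>B. \<Sum>y\<in>B. m x * q x y * (p x * p y * (\<eta> x - \<eta> y)\<^sup>2))"
    unfolding sum_negf[symmetric]
  proof (intro sum_mono)
    fix x y
    have "((\<eta> y)\<^sup>2 * p y - (\<eta> x)\<^sup>2 * p x) * (p y - p x)
        = (\<eta> x * p x - \<eta> y * p y)\<^sup>2 - p x * p y * (\<eta> x - \<eta> y)\<^sup>2"
      by (simp add: power2_eq_square algebra_simps)
    then have "- (((\<eta> y)\<^sup>2 * p y - (\<eta> x)\<^sup>2 * p x) * (p y - p x)) \<le> p x * p y * (\<eta> x - \<eta> y)\<^sup>2"
      by simp
    then have "m x * q x y * - (((\<eta> y)\<^sup>2 * p y - (\<eta> x)\<^sup>2 * p x) * (p y - p x)) \<le> m x * q x y * (p x * p y * (\<eta> x - \<eta> y)\<^sup>2)"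
      by (intro mult_left_mono) auto
    then show "- (m x * q x y * (((\<eta> y)\<^sup>2 * p y - (\<eta> x)\<^sup>2 * p x) * (p y - p x))) \<le> m x * q x y * (p x * p y * (\<eta> x - \<eta> y)\<^sup>2)"
      by simp
  qed
  finally show ?thesis by (simp add: p_def)
qed

text \<open>The Caccioppoli inequality bounds the growth rate of the weighted norm by
  \<open>\<epsilon>\<close>, so this norm minus \<open>\<epsilon> * s\<close> is nonincreasing from
  the value 0. The equation is asked only where \<open>\<eta>\<close> is nonzero, so that Dirichlet
  problems are covered too.\<close>

lemma subsolution_cutoff_bound:
  fixes \<eta> :: "'v \<Rightarrow> real" and W W' :: "real \<Rightarrow> 'v \<Rightarrow> real"
  assumes B: "finite B" "\<And>x. \<eta> x \<noteq> 0 \<Longrightarrow> x \<in> B \<and> nb x \<subseteq> B" and T: "T \<ge> 0"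
    and deriv: "\<And>s x. s \<in> {0..T} \<Longrightarrow> \<eta> x \<noteq> 0 \<Longrightarrow> ((\<lambda>s. W s x) has_real_derivative W' s x) (at s within {0..T})"
    and sub: "\<And>s x. s \<in> {0..T} \<Longrightarrow> \<eta> x \<noteq> 0 \<Longrightarrow> W' s x \<le> laplacian q (W s) x"
    and init: "\<And>x. \<eta> x \<noteq> 0 \<Longrightarrow> W 0 x \<le> 0"
    and eps: "\<And>s. s \<in> {0..T} \<Longrightarrow>
      (\<Sum>x\<in>B. \<Sum>y\<in>B. m x * q x y * (max 0 (W s x) * max 0 (W s y) * (\<eta> x - \<eta> y)\<^sup>2)) \<le> \<epsilon>"
  shows "(\<Sum>x\<in>B. m x * ((\<eta> x)\<^sup>2 * (max 0 (W T x))\<^sup>2)) \<le> \<epsilon> * T"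
proof -
  define F where "F s = (\<Sum>x\<in>B. m x * ((\<eta> x)\<^sup>2 * (max 0 (W s x))\<^sup>2)) - \<epsilon> * s" for s
  define F' where "F' s = (\<Sum>x\<in>B. m x * ((\<eta> x)\<^sup>2 * (2 * max 0 (W s x) * W' s x))) - \<epsilon>" for s
  have F: "(F has_real_derivative F' s) (at s within {0..T})" if s: "s \<in> {0..T}" for s
  proof -
    have "((\<lambda>s. m x * ((\<eta> x)\<^sup>2 * (max 0 (W s x))\<^sup>2)) has_real_derivative
        m x * ((\<eta> x)\<^sup>2 * (2 * max 0 (W s x) * W' s x))) (at s within {0..T})" for x
    proof (cases "\<eta> x = 0")
      case False
      have "((\<lambda>s. (max 0 (W s x))\<^sup>2) has_real_derivative 2 * max 0 (W s x) * W' s x) (at s within {0..T})"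
        by (rule DERIV_chain2[where f = "\<lambda>r. (max 0 r)\<^sup>2", OF DERIV_pos_part_square deriv[OF s False]])
      then show ?thesis by (intro DERIV_cmult)
    qed simp
    then show ?thesis
      unfolding F_def F'_def by (intro DERIV_diff DERIV_sum) (auto intro!: derivative_eq_intros)
  qed
  have F'le: "F' s \<le> 0" if s: "s \<in> {0..T}" for s
  proof -
    have "(\<Sum>x\<in>B. m x * ((\<eta> x)\<^sup>2 * (2 * max 0 (W s x) * W' s x)))
        \<le> (\<Sum>x\<in>B. 2 * (m x * ((\<eta> x)\<^sup>2 * max 0 (W s x)) * laplacian q (W s) x))"
    proof (rule sum_mono)
      fix x
      show "m x * ((\<eta> x)\<^sup>2 * (2 * max 0 (W s x) * W' s x)) \<le> 2 * (m x * ((\<eta> x)\<^sup>2 * max 0 (W s x)) * laplacian q (W s) x)"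
      proof (cases "\<eta> x = 0")
        case False
        have "2 * (m x * ((\<eta> x)\<^sup>2 * max 0 (W s x))) * W' s x \<le> 2 * (m x * ((\<eta> x)\<^sup>2 * max 0 (W s x))) * laplacian q (W s) x"
          using sub[OF s False] by (intro mult_left_mono) auto
        then show ?thesis by (simp add: algebra_simps)
      qed simp
    qed
    also have "\<dots> = 2 * (\<Sum>x\<in>B. m x * ((\<eta> x)\<^sup>2 * max 0 (W s x)) * laplacian q (W s) x)"
      by (simp add: sum_distrib_left)
    also have "\<dots> \<le> \<epsilon>"
      using cutoff_energy_inequality[OF B] eps[OF s] by (rule order_trans)
    finally show ?thesis by (simp add: F'_def)
  qed
  have "F T \<le> F 0"
  proof (rule DERIV_nonpos_imp_decreasing_open[OF T])
    \<comment> \<open>The derivative within \<open>{0..T}\<close> is two-sided in the open interval;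
      at the endpoints continuity is enough.\<close>
    fix s assume s: "0 < s" "s < T"
    then have "(F has_real_derivative F' s) (at s)"
      using F[of s] by (simp add: at_within_Icc_at)
    then show "\<exists>y. (F has_real_derivative y) (at s) \<and> y \<le> 0"
      using F'le[of s] s by auto
  next
    show "continuous_on {0..T} F"
      using F by (meson DERIV_continuous_on)
  qed
  moreover have "F 0 = 0"
  proof -
    have "m x * ((\<eta> x)\<^sup>2 * (max 0 (W 0 x))\<^sup>2) = 0" for x
      using init[of x] by (cases "\<eta> x = 0") auto
    then show ?thesis by (simp only: F_def sum.neutral_const)
  qed
  ultimately show ?thesis by (simp add: F_def)
qed

text \<open>Proved by energy. Outside \<open>S\<close> only a sign is asked for instead of zero
  boundary values, which admits differences of solutions on nested sets.\<close>

lemma maximum_principle: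
  fixes W :: "real \<Rightarrow> 'v \<Rightarrow> real"
  assumes S: "finite S" and T: "T \<ge> 0"
    and deriv: "\<And>s x. s \<in> {0..T} \<Longrightarrow> x \<in> S \<Longrightarrow> ((\<lambda>s. W s x) has_real_derivative laplacian q (W s) x) (at s within {0..T})"
    and init: "\<And>x. x \<in> S \<Longrightarrow> W 0 x \<le> 0"
    and out: "\<And>s x. s \<in> {0..T} \<Longrightarrow> x \<notin> S \<Longrightarrow> W s x \<le> 0"
  shows "W T x \<le> 0"
proof (cases "x \<in> S")
  case True
  define B where "B = S \<union> (\<Union>x\<in>S. nb x)"
  have B: "finite B" using S by (auto simp: B_def)
  \<comment> \<open>The error term of the cutoff \<open>indicator S\<close> vanishes because \<open>W\<^sub>+ = 0\<close> outside \<open>S\<close>.\<close>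
  have "(\<Sum>x\<in>B. m x * ((indicator S x)\<^sup>2 * (max 0 (W T x))\<^sup>2)) \<le> 0 * T"
  proof (rule subsolution_cutoff_bound[OF B _ T, of _ W "\<lambda>s x. laplacian q (W s) x"])
    fix s assume "s \<in> {0..T}"
    then have "max 0 (W s x) * max 0 (W s y) * (indicator S x - indicator S y)\<^sup>2 = (0::real)" for x y
      using out[of s x] out[of s y] by (auto simp: indicator_def max_def)
    then show "(\<Sum>x\<in>B. \<Sum>y\<in>B. m x * q x y *
             (max 0 (W s x) * max 0 (W s y) * (indicator S x - indicator S y)\<^sup>2)) \<le> 0"
      by (simp only: mult_zero_right sum.neutral_const)
  qed (use deriv init in \<open>auto simp: B_def indicator_def split: if_splits\<close>)
  then have "(\<Sum>x\<in>B. m x * ((indicator S x)\<^sup>2 * (max 0 (W T x))\<^sup>2)) = 0"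
    by (intro antisym sum_nonneg) auto
  then have "m x * ((indicator S x)\<^sup>2 * (max 0 (W T x))\<^sup>2) = 0"
    using B True by (subst (asm) sum_nonneg_eq_0_iff) (auto simp: B_def)
  then show ?thesis using True m_pos[of x] by (auto simp: max_def split: if_splits)
qed (use out T in auto)

section \<open>The heat semigroup of a finite set\<close>

abbreviation restr_iter :: "'v set \<Rightarrow> ('v \<Rightarrow> real) \<Rightarrow> nat \<Rightarrow> 'v \<Rightarrow> real" where
  "restr_iter S f k \<equiv> ((laplacian (q_restr q S)) ^^ k) (\<lambda>z. f z * indicator S z)"

lemma restr_iter_outside: "x \<notin> S \<Longrightarrow> restr_iter S f k x = 0"
  by (cases k) (simp_all add: laplacian_restr)

lemma laplacian_abs_le:
  assumes "\<And>x. \<bar>g x\<bar> \<le> M"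
  shows "\<bar>laplacian q g x\<bar> \<le> 2 * M * (\<Sum>y\<in>nb x. q x y)"
proof -
  have "\<bar>laplacian q g x\<bar> \<le> (\<Sum>y\<in>nb x. \<bar>q x y * (g y - g x)\<bar>)"
    unfolding laplacian_def by (rule sum_abs)
  also have "\<dots> \<le> (\<Sum>y\<in>nb x. q x y * (2 * M))"
  proof (intro sum_mono)
    fix y
    have "\<bar>g y - g x\<bar> \<le> 2 * M" using assms[of x] assms[of y] by linarith
    then show "\<bar>q x y * (g y - g x)\<bar> \<le> q x y * (2 * M)"
      by (simp add: abs_mult mult_left_mono)
  qed
  finally show ?thesis by (simp add: sum_distrib_left sum_distrib_right mult.commute)
qed

text \<open>On a finite set the restricted Laplacian is a bounded operator, so its iterates grow at
  most geometrically and the exponential series converges for every time.\<close>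

lemma restr_iter_bound:
  assumes "finite S"
  obtains L M where "\<And>k x. \<bar>restr_iter S f k x\<bar> \<le> M * L ^ k"
proof -
  \<comment> \<open>Sums over \<open>S\<close> stand in for maxima, which would be undefined for the
    empty set.\<close>
  define L where "L = 2 * (\<Sum>x\<in>S. \<Sum>y\<in>nb x. q x y)"
  define M where "M = (\<Sum>x\<in>S. \<bar>f x\<bar>)"
  have M: "M \<ge> 0" unfolding M_def by (intro sum_nonneg) auto
  have L: "L \<ge> 0" unfolding L_def by (intro mult_nonneg_nonneg sum_nonneg) auto
  have "\<bar>restr_iter S f k x\<bar> \<le> M * L ^ k" for k x
  proof (cases "x \<in> S")
    case True
    show ?thesis using True
    proof (induction k arbitrary: x)
      case 0
      then show ?case
        using member_le_sum[of x S "\<lambda>x. \<bar>f x\<bar>"] assms by (simp add: M_def)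
    next
      case (Suc k)
      have *: "\<bar>restr_iter S f k y\<bar> \<le> M * L ^ k" for y
        using Suc.IH[of y] M L by (cases "y \<in> S") (simp_all add: restr_iter_outside)
      have "\<bar>restr_iter S f (Suc k) x\<bar> \<le> 2 * (M * L ^ k) * (\<Sum>y\<in>nb x. q x y)"
        using laplacian_abs_le[OF *, where x = x] Suc.prems by (simp add: laplacian_restr)
      also have "\<dots> \<le> 2 * (M * L ^ k) * (\<Sum>x\<in>S. \<Sum>y\<in>nb x. q x y)"
        using Suc.prems assms M L
        by (intro mult_left_mono member_le_sum[of x S "\<lambda>x. \<Sum>y\<in>nb x. q x y"] sum_nonneg) auto
      finally show ?case by (simp add: L_def mult_ac)
    qed
  qed (use M L in \<open>simp add: restr_iter_outside\<close>)
  then show ?thesis by (rule that)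
qed

lemma summable_restr_iter:
  assumes "finite S"
  shows "summable (\<lambda>k. restr_iter S f k x / fact k * t ^ k)"
proof -
  obtain L M where LM: "\<And>k x. \<bar>restr_iter S f k x\<bar> \<le> M * L ^ k"
    using restr_iter_bound[OF assms] by metis
  show ?thesis
  proof (rule summable_comparison_test')
    show "summable (\<lambda>k. M * (inverse (fact k) * (L * \<bar>t\<bar>) ^ k))"
      by (intro summable_mult summable_exp)
    fix k :: nat
    have "\<bar>restr_iter S f k x\<bar> * (\<bar>t\<bar> ^ k / fact k) \<le> M * L ^ k * (\<bar>t\<bar> ^ k / fact k)"
      by (intro mult_right_mono LM) auto
    then show "norm (restr_iter S f k x / fact k * t ^ k) \<le> M * (inverse (fact k) * (L * \<bar>t\<bar>) ^ k)"
      by (simp add: abs_mult power_abs power_mult_distrib field_simps)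
  qed
qed

lemma heat_fin_power_series:
  "heat_fin q S t f x = (\<Sum>k. restr_iter S f k x / fact k * t ^ k)"
  by (simp add: heat_fin_def mult.commute)

lemma heat_fin_outside: "x \<notin> S \<Longrightarrow> heat_fin q S t f x = 0"
  by (simp add: heat_fin_power_series restr_iter_outside)

lemma heat_fin_0: "heat_fin q S 0 f x = f x * indicator S x"
proof -
  \<comment> \<open>With \<open>0 ^ 0 = 1\<close>, only the term \<open>k = 0\<close> survives at
    time 0.\<close>
  have "heat_fin q S 0 f x = (\<Sum>k\<in>{0}. restr_iter S f k x / fact k * 0 ^ k)"
    unfolding heat_fin_power_series by (rule suminf_finite) auto
  then show ?thesis by simp
qed

text \<open>Termwise differentiation shifts the coefficients by one, which is one more application
  of the restricted Laplacian; that operator is a finite sum and so commutes with the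
  series.\<close>

lemma DERIV_heat_fin:
  assumes S: "finite S"
  shows "((\<lambda>s. heat_fin q S s f x) has_real_derivative laplacian (q_restr q S) (heat_fin q S t f) x) (at t)"
proof -
  have "((\<lambda>s. \<Sum>k. restr_iter S f k x / fact k * s ^ k) has_real_derivative
        (\<Sum>k. diffs (\<lambda>k. restr_iter S f k x / fact k) k * t ^ k)) (at t)"
    by (intro termdiffs_strong_converges_everywhere summable_restr_iter S)
  also have "(\<lambda>k. diffs (\<lambda>k. restr_iter S f k x / fact k) k * t ^ k)
      = (\<lambda>k. \<Sum>y\<in>nb x. q x y * indicator S x *
          (restr_iter S f k y / fact k * t ^ k - restr_iter S f k x / fact k * t ^ k))"
  proof
    fix k
    have "diffs (\<lambda>k. restr_iter S f k x / fact k) k * t ^ k = restr_iter S f (Suc k) x / fact k * t ^ k"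
      by (simp add: diffs_def field_simps del: funpow.simps of_nat_Suc)
    also have "restr_iter S f (Suc k) x = (\<Sum>y\<in>nb x. q x y * indicator S x * (restr_iter S f k y - restr_iter S f k x))"
      by (simp add: laplacian_restr_sum)
    also have "\<dots> / fact k * t ^ k = (\<Sum>y\<in>nb x. q x y * indicator S x *
          (restr_iter S f k y / fact k * t ^ k - restr_iter S f k x / fact k * t ^ k))"
      unfolding sum_divide_distrib sum_distrib_right
      by (intro sum.cong refl) (simp add: algebra_simps diff_divide_distrib)
    finally show "diffs (\<lambda>k. restr_iter S f k x / fact k) k * t ^ k = (\<Sum>y\<in>nb x. q x y * indicator S x *
          (restr_iter S f k y / fact k * t ^ k - restr_iter S f k x / fact k * t ^ k))" .
  qed
  also have "(\<Sum>k. \<Sum>y\<in>nb x. q x y * indicator S x *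
          (restr_iter S f k y / fact k * t ^ k - restr_iter S f k x / fact k * t ^ k))
      = laplacian (q_restr q S) (heat_fin q S t f) x"
    unfolding laplacian_restr_sum[of S "heat_fin q S t f"] heat_fin_power_series
    by (intro sums_unique[symmetric] sums_sum sums_mult sums_diff summable_sums summable_restr_iter S)
  finally show ?thesis by (simp add: heat_fin_power_series[abs_def])
qed

lemma heat_fin_diff:
  assumes S: "finite S"
  shows "heat_fin q S t (\<lambda>x. f x - g x) x = heat_fin q S t f x - heat_fin q S t g x"
proof -
  have iter: "restr_iter S (\<lambda>x. f x - g x) k = (\<lambda>x. restr_iter S f k x - restr_iter S g k x)" for k
  proof (induction k)
    case 0
    then show ?case by (simp add: algebra_simps)
  next
    case (Suc k)
    show ?case
      by (rule ext) (simp only: funpow.simps o_apply Suc.IH laplacian_diff)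
  qed
  show ?thesis
    unfolding heat_fin_power_series iter
    by (simp only: diff_divide_distrib left_diff_distrib suminf_diff[OF summable_restr_iter summable_restr_iter] S)
qed

lemma heat_fin_cong:
  assumes "\<And>x. x \<in> S \<Longrightarrow> f x = g x"
  shows "heat_fin q S t f x = heat_fin q S t g x"
proof -
  have "(\<lambda>z. f z * indicator S z) = (\<lambda>z. g z * indicator S z)"
    using assms by (auto simp: indicator_def)
  then show ?thesis by (simp add: heat_fin_def)
qed

lemma DERIV_heat_fin_inside:
  assumes "finite S" "x \<in> S"
  shows "((\<lambda>s. heat_fin q S s f x) has_real_derivative laplacian q (heat_fin q S t f) x) (at t within A)"
  using DERIV_heat_fin[OF assms(1), of f x t] assms(2)
  by (auto simp: laplacian_restr intro: has_field_derivative_at_within)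

text \<open>Comparison with the constant solution \<open>c\<close>. Outside \<open>S\<close> the
  Dirichlet solution is 0, and \<open>c \<ge> 0\<close> supplies the sign there.\<close>

lemma heat_fin_le:
  assumes S: "finite S" and t: "t \<ge> 0" and f: "\<And>x. x \<in> S \<Longrightarrow> f x \<le> c" and c: "c \<ge> 0"
  shows "heat_fin q S t f x \<le> c"
proof -
  have "heat_fin q S t f x - c \<le> 0"
  proof (rule maximum_principle[OF S t, where W = "\<lambda>s x. heat_fin q S s f x - c"])
    fix s x assume "x \<in> S"
    then show "((\<lambda>s. heat_fin q S s f x - c) has_real_derivative laplacian q (\<lambda>x. heat_fin q S s f x - c) x) (at s within {0..t})"
      unfolding laplacian_minus_const
      by (auto intro!: derivative_eq_intros DERIV_heat_fin_inside S)
  qed (use f c in \<open>auto simp: heat_fin_0 heat_fin_outside\<close>)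
  then show ?thesis by simp
qed

lemma heat_fin_uminus: "finite S \<Longrightarrow> heat_fin q S t (\<lambda>x. - f x) x = - heat_fin q S t f x"
  using heat_fin_diff[of S t "\<lambda>x. 0" f x] heat_fin_diff[of S t "\<lambda>x. 0" "\<lambda>x. 0" x] by simp

lemma heat_fin_nonneg:
  assumes "finite S" "t \<ge> 0" "\<And>x. x \<in> S \<Longrightarrow> f x \<ge> 0"
  shows "heat_fin q S t f x \<ge> 0"
  using heat_fin_le[of S t "\<lambda>x. - f x" 0 x] assms by (simp add: heat_fin_uminus)

lemma heat_fin_abs_le:
  assumes S: "finite S" "t \<ge> 0" and f: "\<And>x. \<bar>f x\<bar> \<le> c"
  shows "\<bar>heat_fin q S t f x\<bar> \<le> c"
proof -
  have *: "f x \<le> c" "- f x \<le> c" for x using f[of x] by linarith+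
  have "c \<ge> 0" using *[of x] by linarith
  then show ?thesis
    using heat_fin_le[OF S, of f c x] heat_fin_le[OF S, of "\<lambda>x. - f x" c x] *
    by (simp add: heat_fin_uminus S abs_le_iff)
qed

lemma heat_fin_mono_fun:
  assumes S: "finite S" "t \<ge> 0" and fg: "\<And>x. f x \<le> g x"
  shows "heat_fin q S t f x \<le> heat_fin q S t g x"
  using heat_fin_nonneg[OF S, of "\<lambda>x. g x - f x" x] fg by (simp add: heat_fin_diff S)

text \<open>Domain monotonicity: outside the smaller set the difference is minus a nonnegative
  solution, so the maximum principle applies on \<open>S\<close>.\<close>

lemma heat_fin_mono:
  assumes S: "finite S'" "S \<subseteq> S'" and t: "t \<ge> 0" and f: "\<And>x. f x \<ge> 0"
  shows "heat_fin q S t f x \<le> heat_fin q S' t f x"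
proof -
  have finS: "finite S" using S finite_subset by blast
  have "heat_fin q S t f x - heat_fin q S' t f x \<le> 0"
  proof (rule maximum_principle[OF finS t, where W = "\<lambda>s x. heat_fin q S s f x - heat_fin q S' s f x"])
    fix s x assume "x \<in> S"
    then show "((\<lambda>s. heat_fin q S s f x - heat_fin q S' s f x) has_real_derivative
        laplacian q (\<lambda>x. heat_fin q S s f x - heat_fin q S' s f x) x) (at s within {0..t})"
      unfolding laplacian_diff using S finS
      by (intro DERIV_diff DERIV_heat_fin_inside) auto
  qed (use f S in \<open>auto simp: heat_fin_0 heat_fin_outside intro!: heat_fin_nonneg\<close>)
  then show ?thesis by simp
qed

section \<open>The heat semigroup as a limit\<close>

lemma heat_fin_convergent_nonneg:
  assumes t: "t \<ge> 0" and f: "\<And>x. f x \<ge> 0" "\<And>x. f x \<le> c"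
  shows "\<exists>L. ((\<lambda>S. heat_fin q S t f x) \<longlongrightarrow> L) (finite_subsets_at_top UNIV)"
proof (rule tendsto_Sup_finite_subsets)
  have "c \<ge> 0" using f[of x] by linarith
  then show "heat_fin q S t f x \<le> c" if "finite S" for S
    using that t f by (intro heat_fin_le) auto
qed (use heat_fin_mono t f in blast)

text \<open>Monotone convergence handles the positive and the negative part separately; linearity
  recombines them.\<close>

lemma heat_tendsto:
  assumes t: "t \<ge> 0" and f: "\<And>x. \<bar>f x\<bar> \<le> c"
  shows "((\<lambda>S. heat_fin q S t f x) \<longlongrightarrow> heat q t f x) (finite_subsets_at_top UNIV)"
proof -
  have *: "max 0 (f y) \<le> c" "max 0 (- f y) \<le> c" for y using f[of y] by linarith+
  obtain L1 where L1: "((\<lambda>S. heat_fin q S t (\<lambda>x. max 0 (f x)) x) \<longlongrightarrow> L1) (finite_subsets_at_top UNIV)"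
    using heat_fin_convergent_nonneg[OF t, of "\<lambda>x. max 0 (f x)" c x] * by auto
  obtain L2 where L2: "((\<lambda>S. heat_fin q S t (\<lambda>x. max 0 (- f x)) x) \<longlongrightarrow> L2) (finite_subsets_at_top UNIV)"
    using heat_fin_convergent_nonneg[OF t, of "\<lambda>x. max 0 (- f x)" c x] * by auto
  have "f = (\<lambda>x. max 0 (f x) - max 0 (- f x))" by (auto simp: max_def)
  then have "heat_fin q S t (\<lambda>x. max 0 (f x)) x - heat_fin q S t (\<lambda>x. max 0 (- f x)) x = heat_fin q S t f x"
    if "finite S" for S
    using heat_fin_diff[OF that, of t "\<lambda>x. max 0 (f x)" "\<lambda>x. max 0 (- f x)" x] by simp
  then have "((\<lambda>S. heat_fin q S t f x) \<longlongrightarrow> L1 - L2) (finite_subsets_at_top UNIV)"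
    by (intro Lim_transform_eventually[OF tendsto_diff[OF L1 L2]] eventually_finite_subsets_at_top_weakI)
  then show ?thesis using heat_eqI by metis
qed

lemma heat_abs_le:
  assumes t: "t \<ge> 0" and f: "\<And>x. \<bar>f x\<bar> \<le> c"
  shows "\<bar>heat q t f x\<bar> \<le> c"
proof (rule tendsto_upperbound[OF tendsto_rabs[OF heat_tendsto[OF t f]]])
  show "\<forall>\<^sub>F S in finite_subsets_at_top UNIV. \<bar>heat_fin q S t f x\<bar> \<le> c"
    using heat_fin_abs_le t f by (intro eventually_finite_subsets_at_top_weakI) auto
qed simp

lemma eventually_mem_finite_subsets: "eventually (\<lambda>S. finite S \<and> X \<subseteq> S) (finite_subsets_at_top UNIV)"
  if "finite X"
  using that by (auto simp: eventually_finite_subsets_at_top)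

lemma heat_0:
  assumes "\<And>x. \<bar>f x\<bar> \<le> c"
  shows "heat q 0 f x = f x"
proof (rule heat_eqI)
  show "((\<lambda>S. heat_fin q S 0 f x) \<longlongrightarrow> f x) (finite_subsets_at_top UNIV)"
    by (rule tendsto_eventually, rule eventually_mono[OF eventually_mem_finite_subsets[of "{x}"]])
      (auto simp: heat_fin_0)
qed

text \<open>The remainder does not depend on \<open>S\<close>, so the expansion survives the limit and yields the
  time derivative of the limit semigroup.\<close>

lemma heat_fin_taylor:
  assumes S: "finite S" "x \<in> S" "nb x \<subseteq> S" and s: "s \<ge> 0" "r \<ge> 0" and f: "\<And>x. \<bar>f x\<bar> \<le> c"
  shows "\<bar>heat_fin q S r f x - heat_fin q S s f x - laplacian q (heat_fin q S s f) x * (r - s)\<bar>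
     \<le> (\<Sum>y\<in>nb x. q x y * (2 * c * (\<Sum>z\<in>nb y. q y z) + 2 * c * (\<Sum>z\<in>nb x. q x z))) * (r - s)\<^sup>2"
    (is "_ \<le> ?K * _")
proof -
  let ?u = "\<lambda>s. heat_fin q S s f" and ?u' = "\<lambda>s. laplacian q (heat_fin q S s f)"
  have bound: "\<bar>?u' s y\<bar> \<le> 2 * c * (\<Sum>z\<in>nb y. q y z)" if "s \<ge> 0" for s y
    by (intro laplacian_abs_le heat_fin_abs_le S that f)
  \<comment> \<open>This is the second time derivative at \<open>x\<close>. As \<open>x\<close> and
    its neighbours lie in \<open>S\<close>, only the full Laplacian at these vertices enters, so the
    bound involves local rates and \<open>c\<close> but not \<open>S\<close>.\<close>
  have bound2: "\<bar>laplacian q (laplacian (q_restr q S) (?u s)) x\<bar> \<le> ?K" if "s \<ge> 0" for s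
  proof -
    have "\<bar>laplacian q (laplacian (q_restr q S) (?u s)) x\<bar> = \<bar>\<Sum>y\<in>nb x. q x y * (?u' s y - ?u' s x)\<bar>"
      unfolding laplacian_def[of q "laplacian (q_restr q S) (?u s)"] using S
      by (intro arg_cong[where f = abs] sum.cong) (auto simp: laplacian_restr)
    also have "\<dots> \<le> (\<Sum>y\<in>nb x. \<bar>q x y * (?u' s y - ?u' s x)\<bar>)"
      by (rule sum_abs)
    also have "\<dots> \<le> ?K"
    proof (intro sum_mono)
      fix y
      have "\<bar>?u' s y - ?u' s x\<bar> \<le> 2 * c * (\<Sum>z\<in>nb y. q y z) + 2 * c * (\<Sum>z\<in>nb x. q x z)"
        using bound[OF that, of x] bound[OF that, of y] by linarith
      then show "\<bar>q x y * (?u' s y - ?u' s x)\<bar> \<le> q x y * (2 * c * (\<Sum>z\<in>nb y. q y z) + 2 * c * (\<Sum>z\<in>nb x. q x z))"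
        by (simp add: abs_mult mult_left_mono)
    qed
    finally show ?thesis .
  qed
  have d1: "((\<lambda>s. ?u s x) has_real_derivative ?u' s x) (at s within A)" for s A
    by (intro DERIV_heat_fin_inside S)
  have d2: "((\<lambda>s. ?u' s x) has_real_derivative laplacian q (laplacian (q_restr q S) (?u s)) x) (at s within A)" for s A
    by (intro has_real_derivative_laplacian has_field_derivative_at_within[OF DERIV_heat_fin] S)
  have lip: "\<bar>?u' a x - ?u' b x\<bar> \<le> ?K * \<bar>a - b\<bar>" if "a \<ge> 0" "b \<ge> 0" for a b
    using field_differentiable_bound[OF convex_real_interval(1)[of 0] d2, where B = ?K and x = a and y = b] that bound2 by auto
  \<comment> \<open>Mean value inequality for the solution minus its linear part at
    \<open>s\<close>: by \<open>lip\<close> the derivative is at most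
    \<open>?K * \<bar>r - s\<bar>\<close> on the segment, which yields the quadratic
    remainder.\<close>
  have "norm ((?u r x - ?u' s x * r) - (?u s x - ?u' s x * s)) \<le> (?K * \<bar>r - s\<bar>) * norm (r - s)"
  proof (rule field_differentiable_bound[of "closed_segment s r" "\<lambda>a. ?u a x - ?u' s x * a" "\<lambda>a. ?u' a x - ?u' s x"])
    fix a assume "a \<in> closed_segment s r"
    then have a: "a \<ge> 0" "\<bar>a - s\<bar> \<le> \<bar>r - s\<bar>"
      using s by (auto simp: closed_segment_eq_real_ivl split: if_splits)
    show "((\<lambda>a. ?u a x - ?u' s x * a) has_real_derivative ?u' a x - ?u' s x) (at a within closed_segment s r)"
      by (rule derivative_eq_intros d1 refl | simp)+
    have "?K \<ge> 0" using bound2[OF s(1)] by linarith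
    then show "norm (?u' a x - ?u' s x) \<le> ?K * \<bar>r - s\<bar>"
      using order_trans[OF lip[OF a(1) s(1)] mult_left_mono[OF a(2)]] by simp
  qed auto
  moreover have "(?u r x - ?u' s x * r) - (?u s x - ?u' s x * s) = ?u r x - ?u s x - ?u' s x * (r - s)"
    by (simp add: right_diff_distrib)
  ultimately show ?thesis
    by (simp only: real_norm_def mult.assoc abs_mult_self_eq power2_eq_square)
qed

lemma DERIV_heat:
  assumes t: "t \<ge> 0" and f: "\<And>x. \<bar>f x\<bar> \<le> c"
  shows "((\<lambda>s. heat q s f x) has_real_derivative laplacian q (heat q t f) x) (at t within {0..})"
proof (rule has_real_derivative_quadratic_bound)
  fix r :: real assume "r \<in> {0..}"
  then have r: "r \<ge> 0" by simp
  let ?K = "\<Sum>y\<in>nb x. q x y * (2 * c * (\<Sum>z\<in>nb y. q y z) + 2 * c * (\<Sum>z\<in>nb x. q x z))"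
  show "\<bar>heat q r f x - heat q t f x - laplacian q (heat q t f) x * (r - t)\<bar> \<le> ?K * (r - t)\<^sup>2"
  proof (rule tendsto_upperbound)
    show "((\<lambda>S. \<bar>heat_fin q S r f x - heat_fin q S t f x - laplacian q (heat_fin q S t f) x * (r - t)\<bar>)
      \<longlongrightarrow> \<bar>heat q r f x - heat q t f x - laplacian q (heat q t f) x * (r - t)\<bar>) (finite_subsets_at_top UNIV)"
      by (intro tendsto_intros tendsto_laplacian heat_tendsto[OF _ f] r t)
    have "eventually (\<lambda>S. finite S \<and> insert x (nb x) \<subseteq> S) (finite_subsets_at_top UNIV)"
      by (intro eventually_mem_finite_subsets) simp
    then show "\<forall>\<^sub>F S in finite_subsets_at_top UNIV.
      \<bar>heat_fin q S r f x - heat_fin q S t f x - laplacian q (heat_fin q S t f) x * (r - t)\<bar> \<le> ?K * (r - t)\<^sup>2"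
      by (rule eventually_mono) (use heat_fin_taylor t r f in auto)
  qed simp
qed

section \<open>Energy estimates\<close>

text \<open>The defect in the product rule for increments along an edge is the product of the
  increments.\<close>

lemma Gamma_k_1: "Gamma_k q (Suc 0) f g x = (\<Sum>y\<in>nb x. q x y * ((f y - f x) * (g y - g x))) / 2"
  by (simp add: laplacian_def sum_distrib_left sum_distrib_right sum_subtractf[symmetric] algebra_simps)

lemma Gamma_eq: "Gamma q f x = (\<Sum>y\<in>nb x. q x y * (f y - f x)\<^sup>2) / 2"
  unfolding Gamma_def by (simp only: One_nat_def Gamma_k_1 power2_eq_square)

lemma Gamma_nonneg [simp]: "Gamma q f x \<ge> 0"
  unfolding Gamma_eq by (intro divide_nonneg_nonneg sum_nonneg) auto

lemma laplacian_square: "laplacian q (\<lambda>x. (f x)\<^sup>2) x = 2 * f x * laplacian q f x + 2 * Gamma q f x"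
proof -
  have "2 * Gamma q f x = (\<Sum>y\<in>nb x. q x y * (f y - f x)\<^sup>2)"
    by (simp add: Gamma_eq)
  then show ?thesis
    unfolding laplacian_def
    by (simp add: sum_distrib_left sum.distrib[symmetric] power2_eq_square algebra_simps)
qed

text \<open>This is \<Gamma>_2 \<ge> 0 with its two mixed terms merged by symmetry. Along the heat
  flow the left side is the time derivative of \<Gamma>(u), so \<Gamma>(u) is a subsolution.\<close>

lemma CD0inf_Gamma:
  assumes "CD0inf q"
  shows "2 * Gamma_k q (Suc 0) f (laplacian q f) x \<le> laplacian q (Gamma q f) x"
proof -
  have "Gamma_k q (Suc 0) (laplacian q f) f x = Gamma_k q (Suc 0) f (laplacian q f) x"
    unfolding Gamma_k_1 by (simp add: mult.commute)
  moreover have "0 \<le> Gamma_k q (Suc (Suc 0)) f f x"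
    using assms by (simp only: CD0inf_def numeral_2_eq_2)
  ultimately show ?thesis
    unfolding Gamma_k.simps(2)[of q "Suc 0"] Gamma_def[abs_def] by (simp del: Gamma_k.simps)
qed

lemma sum_laplacian_energy:
  assumes B: "finite B" "\<And>x. V x \<noteq> 0 \<Longrightarrow> x \<in> B \<and> nb x \<subseteq> B"
  shows "2 * (\<Sum>x\<in>B. m x * V x * laplacian q V x) = - (\<Sum>x\<in>B. \<Sum>y\<in>B. m x * q x y * (V y - V x)\<^sup>2)"
  using sum_laplacian[OF B, of V] sum_by_parts[OF B(1), of V V] by (simp add: power2_eq_square)

text \<open>The time derivative of the norm is minus the Dirichlet energy. An abstract
  \<open>V\<close> is used because the estimate serves both the solution and its time
  derivative.\<close>

lemma dirichlet_l2_decreasing: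
  assumes S: "finite S" and T: "T \<ge> 0"
    and deriv: "\<And>s x. x \<in> S \<Longrightarrow> ((\<lambda>s. V s x) has_real_derivative laplacian q (V s) x) (at s)"
    and out: "\<And>s x. x \<notin> S \<Longrightarrow> V s x = 0"
  shows "(\<Sum>x\<in>S. m x * (V T x)\<^sup>2) \<le> (\<Sum>x\<in>S. m x * (V 0 x)\<^sup>2)"
proof (rule DERIV_nonpos_imp_nonincreasing[OF T])
  fix s
  define B where "B = S \<union> (\<Union>x\<in>S. nb x)"
  have B: "finite B" "\<And>x. V s x \<noteq> 0 \<Longrightarrow> x \<in> B \<and> nb x \<subseteq> B"
    using S out by (auto simp: B_def)
  have d: "((\<lambda>s. \<Sum>x\<in>S. m x * (V s x)\<^sup>2) has_real_derivative (\<Sum>x\<in>S. m x * (2 * V s x * laplacian q (V s) x))) (at s)"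
    by (intro DERIV_sum DERIV_cmult) (auto intro!: derivative_eq_intros deriv)
  have "(\<Sum>x\<in>S. m x * (2 * V s x * laplacian q (V s) x)) = 2 * (\<Sum>x\<in>B. m x * V s x * laplacian q (V s) x)"
    unfolding sum_distrib_left using B(1) out
    by (intro sum.mono_neutral_cong_left) (auto simp: B_def)
  moreover have "0 \<le> (\<Sum>x\<in>B. \<Sum>y\<in>B. m x * q x y * (V s y - V s x)\<^sup>2)"
    by (intro sum_nonneg) auto
  ultimately have "(\<Sum>x\<in>S. m x * (2 * V s x * laplacian q (V s) x)) \<le> 0"
    using sum_laplacian_energy[of B "V s", OF B] by linarith
  with d show "\<exists>y. ((\<lambda>s. \<Sum>x\<in>S. m x * (V s x)\<^sup>2) has_real_derivative y) (at s) \<and> y \<le> 0"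
    by (intro exI conjI)
qed

text \<open>Green's formula turns the total energy into a pairing of \<open>V\<close> with its
  Laplacian, which is supported in \<open>S\<close>; squares then bound the pairing. The bound is
  uniform in \<open>A\<close>.\<close>

lemma sum_Gamma_le:
  assumes S: "finite S" "\<And>x. x \<notin> S \<Longrightarrow> V x = 0" and A: "finite A"
  shows "(\<Sum>x\<in>A. m x * Gamma q V x) \<le> (\<Sum>x\<in>S. m x * (V x)\<^sup>2) + (\<Sum>x\<in>S. m x * (laplacian q V x)\<^sup>2)"
proof -
  \<comment> \<open>The box contains the neighbours of \<open>S\<close> for Green's formula and
    those of \<open>A\<close> so that \<Gamma> is complete at every vertex of
    \<open>A\<close>.\<close>
  define B where "B = S \<union> (\<Union>x\<in>S. nb x) \<union> A \<union> (\<Union>x\<in>A. nb x)"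
  have B: "finite B" "\<And>x. V x \<noteq> 0 \<Longrightarrow> x \<in> B \<and> nb x \<subseteq> B"
    using S A by (auto simp: B_def)
  have "2 * (\<Sum>x\<in>A. m x * Gamma q V x) = (\<Sum>x\<in>A. \<Sum>y\<in>B. m x * q x y * (V y - V x)\<^sup>2)"
    unfolding sum_distrib_left
  proof (rule sum.cong[OF refl])
    fix x assume "x \<in> A"
    then have "nb x \<subseteq> B" by (auto simp: B_def)
    then have "2 * Gamma q V x = (\<Sum>y\<in>B. q x y * (V y - V x)\<^sup>2)"
      unfolding Gamma_eq by (subst sum_nb[OF B(1)]) auto
    then show "2 * (m x * Gamma q V x) = (\<Sum>y\<in>B. m x * q x y * (V y - V x)\<^sup>2)"
      by (simp add: sum_distrib_left mult.assoc mult.left_commute[of 2])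
  qed
  also have "\<dots> \<le> (\<Sum>x\<in>B. \<Sum>y\<in>B. m x * q x y * (V y - V x)\<^sup>2)"
    using B(1) by (intro sum_mono2) (auto simp: B_def intro!: sum_nonneg)
  also have "\<dots> = 2 * (\<Sum>x\<in>B. m x * - (V x * laplacian q V x))"
    using sum_laplacian_energy[OF B] by (simp add: sum_negf mult.assoc)
  also have "(\<Sum>x\<in>B. m x * - (V x * laplacian q V x)) = (\<Sum>x\<in>S. m x * - (V x * laplacian q V x))"
    using B(1) S by (intro sum.mono_neutral_cong_right) (auto simp: B_def)
  also have "\<dots> \<le> (\<Sum>x\<in>S. m x * ((V x)\<^sup>2 + (laplacian q V x)\<^sup>2))"
  proof (intro sum_mono mult_left_mono)
    fix x
    have "0 \<le> (V x + laplacian q V x)\<^sup>2 + (V x)\<^sup>2 + (laplacian q V x)\<^sup>2" by simp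
    then have "0 \<le> 2 * ((V x)\<^sup>2 + (laplacian q V x)\<^sup>2 + V x * laplacian q V x)"
      by (simp add: power2_eq_square algebra_simps)
    then show "- (V x * laplacian q V x) \<le> (V x)\<^sup>2 + (laplacian q V x)\<^sup>2" by simp
  qed simp
  finally show ?thesis by (simp add: algebra_simps sum.distrib)
qed

lemma fin_supp_bounded:
  assumes "fin_supp f"
  shows "\<exists>c. \<forall>x. \<bar>f x\<bar> \<le> c"
proof (intro exI allI)
  fix x
  show "\<bar>f x\<bar> \<le> (\<Sum>y\<in>{y. f y \<noteq> 0}. \<bar>f y\<bar>)"
    using assms member_le_sum[of x "{y. f y \<noteq> 0}" "\<lambda>y. \<bar>f y\<bar>"]
    by (cases "f x = 0") (auto simp: fin_supp_def sum_nonneg)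
qed

text \<open>By symmetry of adjacency, the vertices that see the support are neighbours of it, and
  local finiteness leaves finitely many.\<close>

lemma fin_supp_laplacian:
  assumes "fin_supp f"
  shows "fin_supp (laplacian q f)"
proof -
  let ?A = "{x. f x \<noteq> 0}"
  have "laplacian q f x = 0" if "x \<notin> ?A \<union> (\<Union>y\<in>?A. nb y)" for x
    unfolding laplacian_def
  proof (rule sum.neutral, rule ballI)
    fix y assume "y \<in> nb x"
    then have "x \<in> nb y" by (subst nb_sym)
    then show "q x y * (f y - f x) = 0" using that by auto
  qed
  then have "{x. laplacian q f x \<noteq> 0} \<subseteq> ?A \<union> (\<Union>y\<in>?A. nb y)" by blast
  then show ?thesis
    using assms unfolding fin_supp_def by (elim finite_subset) simp
qed

lemma sum_square_le:
  assumes "finite A" "finite S" "\<And>x. x \<in> S - A \<Longrightarrow> f x = 0"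
  shows "(\<Sum>x\<in>S. m x * (f x)\<^sup>2) \<le> (\<Sum>x\<in>A. m x * (f x)\<^sup>2)"
proof -
  have "(\<Sum>x\<in>S. m x * (f x)\<^sup>2) = (\<Sum>x\<in>S \<inter> A. m x * (f x)\<^sup>2)"
    using assms by (intro sum.mono_neutral_right) auto
  also have "\<dots> \<le> (\<Sum>x\<in>A. m x * (f x)\<^sup>2)"
    using assms by (intro sum_mono2) auto
  finally show ?thesis .
qed

text \<open>On a finite set containing the support of \<open>f\<close>, the norms of the Dirichlet
  solution and of its time derivative are controlled by their values at time 0. The resulting
  \<open>C0\<close> and \<open>C1\<close> depend on \<open>f\<close> alone, so the estimates pass to
  the limit.\<close>

lemma heat_l1_energy:
  assumes f: "fin_supp f"
  obtains C where
    "\<And>t A. t \<ge> 0 \<Longrightarrow> finite A \<Longrightarrow> (\<Sum>x\<in>A. m x * Gamma q (heat q t f) x) \<le> C"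
    "\<And>t A. t \<ge> 0 \<Longrightarrow> finite A \<Longrightarrow> (\<Sum>x\<in>A. m x * (heat q t f x)\<^sup>2) \<le> C"
proof -
  obtain c where c: "\<And>x. \<bar>f x\<bar> \<le> c" using fin_supp_bounded[OF f] by blast
  define A0 where "A0 = {x. f x \<noteq> 0}"
  define A1 where "A1 = {x. laplacian q f x \<noteq> 0}"
  have A0: "finite A0" and A1: "finite A1"
    using f fin_supp_laplacian[OF f] by (auto simp: A0_def A1_def fin_supp_def)
  define C0 where "C0 = (\<Sum>x\<in>A0. m x * (f x)\<^sup>2)"
  define C1 where "C1 = (\<Sum>x\<in>A1. m x * (laplacian q f x)\<^sup>2)"
  have C1: "C1 \<ge> 0" unfolding C1_def by (intro sum_nonneg) auto
  have E0: "(\<Sum>x\<in>S. m x * (heat_fin q S t f x)\<^sup>2) \<le> C0" if t: "t \<ge> 0" and S: "finite S" for t S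
  proof -
    have "(\<Sum>x\<in>S. m x * (heat_fin q S t f x)\<^sup>2) \<le> (\<Sum>x\<in>S. m x * (heat_fin q S 0 f x)\<^sup>2)"
      by (rule dirichlet_l2_decreasing[OF S t, of "\<lambda>s. heat_fin q S s f"])
        (auto intro: DERIV_heat_fin_inside S simp: heat_fin_outside)
    also have "\<dots> = (\<Sum>x\<in>S. m x * (f x)\<^sup>2)"
      by (intro sum.cong) (auto simp: heat_fin_0)
    also have "\<dots> \<le> C0"
      unfolding C0_def using A0 S by (intro sum_square_le) (auto simp: A0_def)
    finally show ?thesis .
  qed
  have E1: "(\<Sum>x\<in>S. m x * (laplacian q (heat_fin q S t f) x)\<^sup>2) \<le> C1"
    if t: "t \<ge> 0" and S: "finite S" "A0 \<subseteq> S" for t S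
  proof -
    \<comment> \<open>The time derivative solves the same equation, so its norm at time 0 controls it.\<close>
    let ?V = "\<lambda>s. laplacian (q_restr q S) (heat_fin q S s f)"
    have "(\<Sum>x\<in>S. m x * (?V t x)\<^sup>2) \<le> (\<Sum>x\<in>S. m x * (?V 0 x)\<^sup>2)"
    proof (rule dirichlet_l2_decreasing[OF S(1) t, of ?V])
      fix s x assume "x \<in> S"
      then have "laplacian q (?V s) x = laplacian (q_restr q S) (?V s) x"
        by (simp add: laplacian_restr)
      then show "((\<lambda>s. ?V s x) has_real_derivative laplacian q (?V s) x) (at s)"
        using has_real_derivative_laplacian[OF DERIV_heat_fin[OF S(1)], of "q_restr q S"] by simp
    qed (simp add: laplacian_restr)
    also have "(\<Sum>x\<in>S. m x * (?V t x)\<^sup>2) = (\<Sum>x\<in>S. m x * (laplacian q (heat_fin q S t f) x)\<^sup>2)"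
      by (intro sum.cong) (auto simp: laplacian_restr)
    also have "(\<Sum>x\<in>S. m x * (?V 0 x)\<^sup>2) = (\<Sum>x\<in>S. m x * (laplacian q f x)\<^sup>2)"
    proof -
      \<comment> \<open>Because \<open>S\<close> contains the support, truncation leaves the initial
        datum intact, and the initial time derivative on \<open>S\<close> is the Laplacian of
        \<open>f\<close>.\<close>
      have "heat_fin q S 0 f = f" using S by (intro ext) (auto simp: heat_fin_0 A0_def indicator_def)
      then show ?thesis by (intro sum.cong) (auto simp: laplacian_restr)
    qed
    also have "\<dots> \<le> C1"
      unfolding C1_def using A1 S by (intro sum_square_le) (auto simp: A1_def)
    finally show ?thesis .
  qed
  show ?thesis
  proof (rule that)
    fix t :: real and A :: "'v set" assume t: "t \<ge> 0" and A: "finite A"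
    note lim = heat_tendsto[OF t c]
    have ev: "eventually (\<lambda>S. finite S \<and> A \<union> A0 \<subseteq> S) (finite_subsets_at_top UNIV)"
      using A A0 by (intro eventually_mem_finite_subsets) auto
    show "(\<Sum>x\<in>A. m x * Gamma q (heat q t f) x) \<le> C0 + C1"
    proof (rule tendsto_upperbound)
      show "((\<lambda>S. \<Sum>x\<in>A. m x * Gamma q (heat_fin q S t f) x) \<longlongrightarrow> (\<Sum>x\<in>A. m x * Gamma q (heat q t f) x))
        (finite_subsets_at_top UNIV)"
        unfolding Gamma_eq by (intro tendsto_intros lim) auto
      show "\<forall>\<^sub>F S in finite_subsets_at_top UNIV. (\<Sum>x\<in>A. m x * Gamma q (heat_fin q S t f) x) \<le> C0 + C1"
        using ev
      proof (rule eventually_mono)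
        fix S assume S: "finite S \<and> A \<union> A0 \<subseteq> S"
        show "(\<Sum>x\<in>A. m x * Gamma q (heat_fin q S t f) x) \<le> C0 + C1"
          using sum_Gamma_le[of S "heat_fin q S t f" A] E0[OF t, of S] E1[OF t, of S] S A
          by (simp add: heat_fin_outside)
      qed
    qed simp
    show "(\<Sum>x\<in>A. m x * (heat q t f x)\<^sup>2) \<le> C0 + C1"
    proof (rule tendsto_upperbound)
      show "((\<lambda>S. \<Sum>x\<in>A. m x * (heat_fin q S t f x)\<^sup>2) \<longlongrightarrow> (\<Sum>x\<in>A. m x * (heat q t f x)\<^sup>2))
        (finite_subsets_at_top UNIV)"
        by (intro tendsto_intros lim)
      show "\<forall>\<^sub>F S in finite_subsets_at_top UNIV. (\<Sum>x\<in>A. m x * (heat_fin q S t f x)\<^sup>2) \<le> C0 + C1"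
        using ev
      proof (rule eventually_mono)
        fix S assume S: "finite S \<and> A \<union> A0 \<subseteq> S"
        then have "(\<Sum>x\<in>A. m x * (heat_fin q S t f x)\<^sup>2) \<le> (\<Sum>x\<in>S. m x * (heat_fin q S t f x)\<^sup>2)"
          by (intro sum_mono2) auto
        then show "(\<Sum>x\<in>A. m x * (heat_fin q S t f x)\<^sup>2) \<le> C0 + C1"
          using E0[OF t, of S] S C1 by simp
      qed
    qed simp
  qed
qed

section \<open>The reverse Poincare inequality\<close>

text \<open>The function \<open>H\<^sub>s\<close> of the introduction. The factor
  \<open>2 * s\<close> is chosen so that the term 2 \<Gamma>(u) from its time derivative cancels the
  one in the Laplacian of \<open>u\<^sup>2\<close>.\<close>

definition rev_poincare :: "('v \<Rightarrow> real) \<Rightarrow> real \<Rightarrow> 'v \<Rightarrow> real" where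
  "rev_poincare f s x = 2 * s * Gamma q (heat q s f) x + (heat q s f x)\<^sup>2"

lemma rev_poincare_nonneg: "s \<ge> 0 \<Longrightarrow> rev_poincare f s x \<ge> 0"
  by (simp add: rev_poincare_def)

lemma rev_poincare_l1_bound:
  assumes "fin_supp f"
  obtains C where "\<And>s A. s \<in> {0..T} \<Longrightarrow> finite A \<Longrightarrow> (\<Sum>x\<in>A. m x * rev_poincare f s x) \<le> C"
proof -
  obtain C where C:
    "\<And>t A. t \<ge> 0 \<Longrightarrow> finite A \<Longrightarrow> (\<Sum>x\<in>A. m x * Gamma q (heat q t f) x) \<le> C"
    "\<And>t A. t \<ge> 0 \<Longrightarrow> finite A \<Longrightarrow> (\<Sum>x\<in>A. m x * (heat q t f x)\<^sup>2) \<le> C"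
    using heat_l1_energy[OF assms] by metis
  have C0: "C \<ge> 0" using C(1)[of 0 "{}"] by simp
  show ?thesis
  proof (rule that)
    fix s :: real and A :: "'v set" assume s: "s \<in> {0..T}" and A: "finite A"
    have "(\<Sum>x\<in>A. m x * rev_poincare f s x) = 2 * s * (\<Sum>x\<in>A. m x * Gamma q (heat q s f) x) + (\<Sum>x\<in>A. m x * (heat q s f x)\<^sup>2)"
      by (simp add: rev_poincare_def sum_distrib_left sum.distrib[symmetric] algebra_simps)
    also have "\<dots> \<le> 2 * s * C + C"
      using s A by (intro add_mono mult_left_mono C) auto
    also have "\<dots> \<le> 2 * T * C + C"
      using s C0 by (intro add_mono mult_right_mono) auto
    finally show "(\<Sum>x\<in>A. m x * rev_poincare f s x) \<le> 2 * T * C + C" .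
  qed
qed

lemma DERIV_rev_poincare:
  assumes f: "\<And>x. \<bar>f x\<bar> \<le> c" and s: "s \<ge> 0"
  shows "((\<lambda>s. rev_poincare f s x) has_real_derivative
     2 * Gamma q (heat q s f) x + 4 * s * Gamma_k q (Suc 0) (heat q s f) (laplacian q (heat q s f)) x
     + 2 * heat q s f x * laplacian q (heat q s f) x) (at s within {0..})"
proof -
  let ?u = "\<lambda>s. heat q s f"
  note d = DERIV_heat[OF s f]
  have "((\<lambda>s. Gamma q (?u s) x) has_real_derivative 2 * Gamma_k q (Suc 0) (?u s) (laplacian q (?u s)) x) (at s within {0..})"
  proof -
    have "((\<lambda>s. q x y * (?u s y - ?u s x)\<^sup>2) has_real_derivative
        q x y * (2 * ((?u s y - ?u s x) * (laplacian q (?u s) y - laplacian q (?u s) x)))) (at s within {0..})" for y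
      by (intro DERIV_cmult) (auto intro!: derivative_eq_intros d)
    then have "((\<lambda>s. \<Sum>y\<in>nb x. q x y * (?u s y - ?u s x)\<^sup>2) has_real_derivative
        (\<Sum>y\<in>nb x. q x y * (2 * ((?u s y - ?u s x) * (laplacian q (?u s) y - laplacian q (?u s) x))))) (at s within {0..})"
      by (rule DERIV_sum)
    from DERIV_cdivide[OF this, of 2] show ?thesis
      unfolding Gamma_eq Gamma_k_1 by (simp add: sum_distrib_left sum_divide_distrib algebra_simps)
  qed
  then show ?thesis
    unfolding rev_poincare_def by (auto intro!: derivative_eq_intros d)
qed

text \<open>The left side is the time derivative of \<open>rev_poincare\<close>. After cancelling 2
  \<Gamma>(u) and the term with \<open>u\<close> times its Laplacian, what remains is
  \<open>2 * s\<close> times the curvature inequality.\<close>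

lemma rev_poincare_subsolution:
  assumes "CD0inf q" and s: "s \<ge> 0"
  shows "2 * Gamma q (heat q s f) x + 4 * s * Gamma_k q (Suc 0) (heat q s f) (laplacian q (heat q s f)) x
     + 2 * heat q s f x * laplacian q (heat q s f) x \<le> laplacian q (\<lambda>x. rev_poincare f s x - c) x"
proof -
  have "laplacian q (\<lambda>x. rev_poincare f s x - c) x
      = 2 * s * laplacian q (Gamma q (heat q s f)) x + laplacian q (\<lambda>x. (heat q s f x)\<^sup>2) x"
    by (simp add: laplacian_minus_const rev_poincare_def laplacian_add laplacian_cmult)
  then show ?thesis
    using mult_left_mono[OF CD0inf_Gamma[OF assms(1), of "heat q s f" x], of "2 * s"] s
    by (simp add: laplacian_square del: Gamma_k.simps)
qed

text \<open>This isolates what the conditions (A), (B), (C) must provide: cutoffs not small at the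
  single vertex \<open>x\<close>, whose error is small uniformly in time. As
  \<open>\<epsilon>\<close> is arbitrary, the positive part of \<open>H - c\<^sup>2\<close> vanishes
  at \<open>x\<close>.\<close>

lemma rev_poincare_le:
  assumes CD: "CD0inf q" and f: "\<And>x. \<bar>f x\<bar> \<le> c" and T: "T \<ge> 0"
    and cutoff: "\<And>\<epsilon>. \<epsilon> > 0 \<Longrightarrow> \<exists>\<eta>. fin_supp \<eta> \<and> 1/2 \<le> \<eta> x \<and>
      (\<forall>s\<in>{0..T}. \<forall>B. finite B \<longrightarrow>
        (\<Sum>y\<in>B. \<Sum>z\<in>B. m y * q y z * (rev_poincare f s y * rev_poincare f s z * (\<eta> y - \<eta> z)\<^sup>2)) \<le> \<epsilon>)"
  shows "rev_poincare f T x \<le> c\<^sup>2"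
proof -
  define W where "W s y = rev_poincare f s y - c\<^sup>2" for s y
  define p where "p = max 0 (W T x)"
  \<comment> \<open>As \<open>H\<close> is nonnegative, it dominates \<open>W\<^sub>+\<close>; the
    error can thus be estimated through the summable function \<open>H\<close>.\<close>
  have W_le: "max 0 (W s y) \<le> rev_poincare f s y" if "s \<ge> 0" for s y
    using rev_poincare_nonneg[OF that, of f y] by (simp add: W_def)
  have "m x * (1/4 * p\<^sup>2) \<le> 0 + \<epsilon>" if \<epsilon>: "\<epsilon> > 0" for \<epsilon>
  proof -
    \<comment> \<open>Integration in time costs a factor \<open>T\<close>; dividing by
      \<open>T + 1\<close> absorbs it and stays meaningful at \<open>T = 0\<close>.\<close>
    have "\<epsilon> / (T + 1) > 0" using \<epsilon> T by simp
    from cutoff[OF this] obtain \<eta> where \<eta>: "fin_supp \<eta>" "1/2 \<le> \<eta> x"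
      and R: "\<forall>s\<in>{0..T}. \<forall>B. finite B \<longrightarrow>
        (\<Sum>y\<in>B. \<Sum>z\<in>B. m y * q y z * (rev_poincare f s y * rev_poincare f s z * (\<eta> y - \<eta> z)\<^sup>2)) \<le> \<epsilon> / (T + 1)"
      by blast
    define B where "B = {y. \<eta> y \<noteq> 0} \<union> (\<Union>y\<in>{y. \<eta> y \<noteq> 0}. nb y)"
    have B: "finite B" "x \<in> B" using \<eta> by (auto simp: B_def fin_supp_def)
    have "(\<Sum>y\<in>B. m y * ((\<eta> y)\<^sup>2 * (max 0 (W T y))\<^sup>2)) \<le> \<epsilon> / (T + 1) * T"
    proof (rule subsolution_cutoff_bound[OF B(1) _ T, where W = W])
      fix s y assume s: "s \<in> {0..T}"
      then have s0: "s \<ge> 0" by simp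
      have "((\<lambda>s. W s y) has_real_derivative
         2 * Gamma q (heat q s f) y + 4 * s * Gamma_k q (Suc 0) (heat q s f) (laplacian q (heat q s f)) y
         + 2 * heat q s f y * laplacian q (heat q s f) y - 0) (at s within {0..})"
        unfolding W_def by (intro DERIV_diff DERIV_rev_poincare[OF f s0] DERIV_const)
      then show "((\<lambda>s. W s y) has_real_derivative
         2 * Gamma q (heat q s f) y + 4 * s * Gamma_k q (Suc 0) (heat q s f) (laplacian q (heat q s f)) y
         + 2 * heat q s f y * laplacian q (heat q s f) y) (at s within {0..T})"
        unfolding diff_0_right by (rule DERIV_subset) auto
      show "2 * Gamma q (heat q s f) y + 4 * s * Gamma_k q (Suc 0) (heat q s f) (laplacian q (heat q s f)) y
         + 2 * heat q s f y * laplacian q (heat q s f) y \<le> laplacian q (W s) y"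
        unfolding W_def by (rule rev_poincare_subsolution[OF CD s0])
    next
      fix y
      have "(f y)\<^sup>2 \<le> c\<^sup>2" using f[of y] by (metis abs_ge_zero power2_abs power_mono)
      then show "W 0 y \<le> 0" by (simp add: W_def rev_poincare_def heat_0[OF f])
    next
      fix s assume s: "s \<in> {0..T}"
      have "(\<Sum>y\<in>B. \<Sum>z\<in>B. m y * q y z * (max 0 (W s y) * max 0 (W s z) * (\<eta> y - \<eta> z)\<^sup>2))
        \<le> (\<Sum>y\<in>B. \<Sum>z\<in>B. m y * q y z * (rev_poincare f s y * rev_poincare f s z * (\<eta> y - \<eta> z)\<^sup>2))"
        using s by (intro sum_mono mult_left_mono mult_right_mono mult_mono W_le) (auto simp: rev_poincare_nonneg)
      also have "\<dots> \<le> \<epsilon> / (T + 1)" using R s B(1) by blast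
      finally show "(\<Sum>y\<in>B. \<Sum>z\<in>B. m y * q y z * (max 0 (W s y) * max 0 (W s z) * (\<eta> y - \<eta> z)\<^sup>2)) \<le> \<epsilon> / (T + 1)" .
    qed (auto simp: B_def)
    moreover have "\<epsilon> / (T + 1) * T \<le> \<epsilon>"
      using \<epsilon> T by (simp add: field_simps)
    moreover have "m x * ((\<eta> x)\<^sup>2 * p\<^sup>2) \<le> (\<Sum>y\<in>B. m y * ((\<eta> y)\<^sup>2 * (max 0 (W T y))\<^sup>2))"
      unfolding p_def using B by (intro member_le_sum[of x B "\<lambda>y. m y * ((\<eta> y)\<^sup>2 * (max 0 (W T y))\<^sup>2)"]) auto
    \<comment> \<open>The factor 1/4 is the square of the lower bound 1/2 for
      \<open>\<eta> x\<close>.\<close>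
    moreover have "m x * (1/4 * p\<^sup>2) \<le> m x * ((\<eta> x)\<^sup>2 * p\<^sup>2)"
      using power_mono[OF \<eta>(2), of 2] by (intro mult_left_mono mult_right_mono) (auto simp: power2_eq_square)
    ultimately show ?thesis by linarith
  qed
  then have "m x * (1/4 * p\<^sup>2) \<le> 0" by (rule field_le_epsilon)
  then have "p = 0" using m_pos[of x] by (auto simp: mult_le_0_iff)
  then show ?thesis by (simp add: p_def W_def max_def split: if_splits)
qed

section \<open>Graph distance and error estimates for cutoffs\<close>

lemma graph_dist_relpow:
  assumes "connected_graph q"
  shows "(x, y) \<in> adj q ^^ graph_dist q x y"
proof -
  have "\<exists>n. (x, y) \<in> adj q ^^ n"
    using assms unfolding connected_graph_def rtrancl_power by blast
  then show ?thesis unfolding graph_dist_def by (rule LeastI_ex)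
qed

lemma graph_dist_le: "(x, y) \<in> adj q ^^ n \<Longrightarrow> graph_dist q x y \<le> n"
  unfolding graph_dist_def by (rule Least_le)

lemma graph_dist_refl: "graph_dist q x x = 0"
  using graph_dist_le[of x x 0] by simp

lemma graph_dist_step:
  assumes "connected_graph q" "z \<in> nb y"
  shows "graph_dist q x z \<le> Suc (graph_dist q x y)"
proof (rule graph_dist_le)
  have "(y, z) \<in> adj q" using assms(2) by (simp add: adj_def)
  with graph_dist_relpow[OF assms(1)] show "(x, z) \<in> adj q ^^ Suc (graph_dist q x y)"
    by (rule relpow_Suc_I)
qed

text \<open>Endpoints of walks rather than of geodesics: in a connected graph they include the
  sphere of radius \<open>n\<close>, and they allow induction by one step of local
  finiteness.\<close>

lemma finite_sphere: "finite {y. (x, y) \<in> adj q ^^ n}"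
proof (induction n)
  case (Suc n)
  have "{y. (x, y) \<in> adj q ^^ Suc n} = (\<Union>z\<in>{z. (x, z) \<in> adj q ^^ n}. nb z)"
    by (auto simp: adj_def)
  then show ?case using Suc by simp
qed simp

text \<open>A tent of height 1 and radius \<open>N\<close>. Across an edge the distance changes by
  at most 1 in either direction, by symmetry of adjacency, so the tent changes by at most
  \<open>1 / N\<close>.\<close>

lemma cutoff_distance:
  fixes x :: 'v and N :: nat
  assumes conn: "connected_graph q" and "N > 0"
  defines "\<eta> \<equiv> \<lambda>y. max 0 (1 - real (graph_dist q x y) / real N)"
  shows "fin_supp \<eta>" "\<eta> x = 1" "\<And>y z. z \<in> nb y \<Longrightarrow> \<bar>\<eta> y - \<eta> z\<bar> \<le> 1 / real N"
proof -
  have "{y. \<eta> y \<noteq> 0} \<subseteq> (\<Union>n\<le>N. {y. (x, y) \<in> adj q ^^ n})"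
  proof
    fix y assume "y \<in> {y. \<eta> y \<noteq> 0}"
    then have "graph_dist q x y \<le> N"
      using \<open>N > 0\<close> by (auto simp: \<eta>_def max_def field_simps split: if_splits)
    then show "y \<in> (\<Union>n\<le>N. {y. (x, y) \<in> adj q ^^ n})"
      using graph_dist_relpow[OF conn] by auto
  qed
  then show "fin_supp \<eta>" unfolding fin_supp_def by (rule finite_subset) (simp add: finite_sphere)
  show "\<eta> x = 1" by (simp add: \<eta>_def graph_dist_refl)
  fix y z assume z: "z \<in> nb y"
  then have y: "y \<in> nb z" by (subst nb_sym)
  have "\<bar>real (graph_dist q x z) - real (graph_dist q x y)\<bar> \<le> 1"
    using graph_dist_step[OF conn z, of x] graph_dist_step[OF conn y, of x] by linarith
  then have "\<bar>real (graph_dist q x z) / N - real (graph_dist q x y) / N\<bar> \<le> 1 / N"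
    using \<open>N > 0\<close> by (simp add: diff_divide_distrib[symmetric] divide_right_mono)
  then show "\<bar>\<eta> y - \<eta> z\<bar> \<le> 1 / real N" by (simp add: \<eta>_def max_def abs_if split: if_splits)
qed

text \<open>Each edge contributes at most \<open>\<delta>\<^sup>2\<close>; the inner sum is then
  bounded by \<open>D\<close> and the outer one by \<open>C\<close>. Loops disappear since the
  cutoff does not change along them, which is why \<open>D\<close> only has to bound the sum off the
  diagonal.\<close>

lemma sum_sum_cutoff_distance:
  assumes H: "\<And>y. H y \<ge> 0" and C: "\<And>A. finite A \<Longrightarrow> (\<Sum>y\<in>A. m y * H y) \<le> C"
    and D: "\<And>A y. finite A \<Longrightarrow> (\<Sum>z\<in>A - {y}. q y z * H z) \<le> D"
    and \<eta>: "\<And>y z. z \<in> nb y \<Longrightarrow> \<bar>\<eta> y - \<eta> z\<bar> \<le> \<delta>" and B: "finite B"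
  shows "(\<Sum>y\<in>B. \<Sum>z\<in>B. m y * q y z * (H y * H z * (\<eta> y - \<eta> z)\<^sup>2)) \<le> C * D * \<delta>\<^sup>2"
proof -
  have D0: "D \<ge> 0" using D[of "{}"] by simp
  have "(\<Sum>z\<in>B. m y * q y z * (H y * H z * (\<eta> y - \<eta> z)\<^sup>2)) \<le> m y * H y * (D * \<delta>\<^sup>2)" for y
  proof -
    have "(\<Sum>z\<in>B. m y * q y z * (H y * H z * (\<eta> y - \<eta> z)\<^sup>2))
        = (\<Sum>z\<in>B - {y}. m y * q y z * (H y * H z * (\<eta> y - \<eta> z)\<^sup>2))"
      using B by (intro sum.mono_neutral_right) auto
    also have "\<dots> \<le> (\<Sum>z\<in>B - {y}. m y * H y * \<delta>\<^sup>2 * (q y z * H z))"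
    proof (intro sum_mono)
      fix z
      show "m y * q y z * (H y * H z * (\<eta> y - \<eta> z)\<^sup>2) \<le> m y * H y * \<delta>\<^sup>2 * (q y z * H z)"
      proof (cases "z \<in> nb y")
        case True
        have "(\<eta> y - \<eta> z)\<^sup>2 \<le> \<delta>\<^sup>2"
          using power_mono[OF \<eta>[OF True], of 2] by simp
        then have "(m y * q y z * H y * H z) * (\<eta> y - \<eta> z)\<^sup>2 \<le> (m y * q y z * H y * H z) * \<delta>\<^sup>2"
          using H by (intro mult_left_mono) auto
        then show ?thesis by (simp add: mult_ac)
      qed (simp add: q_zero)
    qed
    also have "\<dots> = m y * H y * \<delta>\<^sup>2 * (\<Sum>z\<in>B - {y}. q y z * H z)"
      by (simp add: sum_distrib_left)
    also have "\<dots> \<le> m y * H y * \<delta>\<^sup>2 * D"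
      using H by (intro mult_left_mono D B) auto
    finally show ?thesis by (simp add: mult_ac)
  qed
  then have "(\<Sum>y\<in>B. \<Sum>z\<in>B. m y * q y z * (H y * H z * (\<eta> y - \<eta> z)\<^sup>2)) \<le> (\<Sum>y\<in>B. m y * H y * (D * \<delta>\<^sup>2))"
    by (rule sum_mono)
  also have "\<dots> = (\<Sum>y\<in>B. m y * H y) * (D * \<delta>\<^sup>2)"
    by (simp add: sum_distrib_right)
  also have "\<dots> \<le> C * (D * \<delta>\<^sup>2)"
    using D0 by (intro mult_right_mono C B) auto
  finally show ?thesis by (simp add: mult_ac)
qed

text \<open>Symmetry of the edge weight and
  \<open>2 * H y * H z \<le> (H y)\<^sup>2 + (H z)\<^sup>2\<close> move all of \<open>H\<close> to
  the outer vertex. The inner sum is then at most twice the \<Gamma> of the cutoff, and one of the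
  two factors \<open>H y\<close> is bounded by \<open>M\<close>.\<close>

lemma sum_sum_cutoff_Gamma:
  assumes H: "\<And>y. H y \<ge> 0" "\<And>y. H y \<le> M" and C: "\<And>A. finite A \<Longrightarrow> (\<Sum>y\<in>A. m y * H y) \<le> C"
    and \<eta>: "\<And>y. Gamma q \<eta> y \<le> \<delta>" and B: "finite B"
  shows "(\<Sum>y\<in>B. \<Sum>z\<in>B. m y * q y z * (H y * H z * (\<eta> y - \<eta> z)\<^sup>2)) \<le> 2 * C * M * \<delta>"
proof -
  define w where "w y z = m y * q y z * (\<eta> y - \<eta> z)\<^sup>2" for y z
  have w: "w y z \<ge> 0" "w y z = w z y" for y z
    by (simp_all add: w_def detailed_balance[of y z] power2_commute)
  have M: "M \<ge> 0" using H order_trans by blast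
  have \<delta>: "\<delta> \<ge> 0" using \<eta> Gamma_nonneg order_trans by blast
  have "2 * (\<Sum>y\<in>B. \<Sum>z\<in>B. w y z * (H y * H z)) \<le> (\<Sum>y\<in>B. \<Sum>z\<in>B. w y z * (H y)\<^sup>2) + (\<Sum>y\<in>B. \<Sum>z\<in>B. w y z * (H z)\<^sup>2)"
    unfolding sum_distrib_left sum.distrib[symmetric]
  proof (intro sum_mono)
    fix y z
    have "w y z * (2 * H y * H z) \<le> w y z * ((H y)\<^sup>2 + (H z)\<^sup>2)"
      by (intro mult_left_mono w sum_squares_bound)
    then show "2 * (w y z * (H y * H z)) \<le> w y z * (H y)\<^sup>2 + w y z * (H z)\<^sup>2"
      by (simp add: algebra_simps)
  qed
  also have "(\<Sum>y\<in>B. \<Sum>z\<in>B. w y z * (H z)\<^sup>2) = (\<Sum>y\<in>B. \<Sum>z\<in>B. w y z * (H y)\<^sup>2)"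
    by (subst sum.swap) (simp add: w(2))
  finally have "(\<Sum>y\<in>B. \<Sum>z\<in>B. w y z * (H y * H z)) \<le> (\<Sum>y\<in>B. \<Sum>z\<in>B. w y z * (H y)\<^sup>2)" by simp
  also have "\<dots> \<le> (\<Sum>y\<in>B. m y * H y * (2 * M * \<delta>))"
  proof (intro sum_mono)
    fix y
    have "(\<Sum>z\<in>B. q y z * (\<eta> z - \<eta> y)\<^sup>2) \<le> (\<Sum>z\<in>B \<union> nb y. q y z * (\<eta> z - \<eta> y)\<^sup>2)"
      using B by (intro sum_mono2) auto
    also have "\<dots> = (\<Sum>z\<in>nb y. q y z * (\<eta> z - \<eta> y)\<^sup>2)"
      using B by (intro sum_nb[symmetric]) auto
    also have "\<dots> \<le> 2 * \<delta>"
      using \<eta>[of y] by (simp add: Gamma_eq)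
    finally have *: "(\<Sum>z\<in>B. q y z * (\<eta> z - \<eta> y)\<^sup>2) \<le> 2 * \<delta>" .
    have "(\<Sum>z\<in>B. w y z * (H y)\<^sup>2) = m y * H y * (H y * (\<Sum>z\<in>B. q y z * (\<eta> z - \<eta> y)\<^sup>2))"
      by (simp add: w_def sum_distrib_left power2_commute[of "\<eta> y"] power2_eq_square[of "H y"] mult_ac)
    also have "\<dots> \<le> m y * H y * (M * (2 * \<delta>))"
      using H M \<delta> by (intro mult_left_mono mult_mono * H sum_nonneg) auto
    finally show "(\<Sum>z\<in>B. w y z * (H y)\<^sup>2) \<le> m y * H y * (2 * M * \<delta>)" by (simp add: mult_ac)
  qed
  also have "\<dots> = (\<Sum>y\<in>B. m y * H y) * (2 * M * \<delta>)" by (simp add: sum_distrib_right)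
  also have "\<dots> \<le> C * (2 * M * \<delta>)"
    using M \<delta> by (intro mult_right_mono C B) auto
  finally show ?thesis by (simp add: w_def mult_ac)
qed

section \<open>The bound under each of the conditions (A), (B) and (C)\<close>

lemma rev_poincare_bound_of_jump_bound:
  assumes CD: "CD0inf q" and conn: "connected_graph q"
    and f: "fin_supp f" "\<And>x. \<bar>f x\<bar> \<le> c" and T: "T \<ge> 0"
    and D: "\<And>s A y. s \<in> {0..T} \<Longrightarrow> finite A \<Longrightarrow> (\<Sum>z\<in>A - {y}. q y z * rev_poincare f s z) \<le> D"
  shows "rev_poincare f T x \<le> c\<^sup>2"
proof (rule rev_poincare_le[OF CD f(2) T])
  fix \<epsilon> :: real assume \<epsilon>: "\<epsilon> > 0"
  obtain C where C: "\<And>s A. s \<in> {0..T} \<Longrightarrow> finite A \<Longrightarrow> (\<Sum>x\<in>A. m x * rev_poincare f s x) \<le> C"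
    using rev_poincare_l1_bound[OF f(1), of T] by blast
  have CD0: "C * D \<ge> 0" using C[of 0 "{}"] D[of 0 "{}"] T by (intro mult_nonneg_nonneg) auto
  \<comment> \<open>The tent of radius \<open>N\<close> has error at most
    \<open>C * D / N\<^sup>2\<close>, hence at most \<open>C * D / N\<close>; this choice of
    \<open>N\<close> brings it below \<open>\<epsilon>\<close>.\<close>
  obtain N :: nat where N: "C * D / \<epsilon> < real N" using reals_Archimedean2 by blast
  then have N0: "N > 0" using CD0 \<epsilon> by (cases "N = 0") (auto simp: divide_less_0_iff not_less[symmetric])
  then have "(1 / real N)\<^sup>2 \<le> 1 / real N"
    by (simp add: power2_eq_square divide_simps)
  then have "C * D * (1 / real N)\<^sup>2 \<le> C * D * (1 / real N)"
    by (rule mult_left_mono[OF _ CD0])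
  also have "\<dots> \<le> \<epsilon>" using N N0 \<epsilon> by (simp add: field_simps)
  finally have le: "C * D * (1 / real N)\<^sup>2 \<le> \<epsilon>" .
  show "\<exists>\<eta>. fin_supp \<eta> \<and> 1/2 \<le> \<eta> x \<and> (\<forall>s\<in>{0..T}. \<forall>B. finite B \<longrightarrow>
    (\<Sum>y\<in>B. \<Sum>z\<in>B. m y * q y z * (rev_poincare f s y * rev_poincare f s z * (\<eta> y - \<eta> z)\<^sup>2)) \<le> \<epsilon>)"
  proof (intro exI[of _ "\<lambda>y. max 0 (1 - real (graph_dist q x y) / real N)"] conjI ballI allI impI)
    show "fin_supp (\<lambda>y. max 0 (1 - real (graph_dist q x y) / real N))"
      by (rule cutoff_distance(1)[OF conn N0])
    show "1/2 \<le> max 0 (1 - real (graph_dist q x x) / real N)"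
      by (simp add: graph_dist_refl)
    fix s B assume s: "s \<in> {0..T}" and B: "finite (B :: 'v set)"
    show "(\<Sum>y\<in>B. \<Sum>z\<in>B. m y * q y z * (rev_poincare f s y * rev_poincare f s z *
      (max 0 (1 - real (graph_dist q x y) / real N) - max 0 (1 - real (graph_dist q x z) / real N))\<^sup>2)) \<le> \<epsilon>"
      by (rule order_trans[OF sum_sum_cutoff_distance le])
        (use s C D B cutoff_distance(3)[OF conn N0] in \<open>auto intro: rev_poincare_nonneg\<close>)
  qed
qed

text \<open>The solution is bounded by \<open>c\<close> and its increments by \<open>2 * c\<close>,
  so bounded rates \<open>K\<close> bound \<Gamma> and with it \<open>H\<close>. Applying the rate
  bound once more to the sum of \<open>q y z * H z\<close> gives the jump bound.\<close>

lemma rev_poincare_bound_A: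
  assumes CD: "CD0inf q" and conn: "connected_graph q"
    and f: "fin_supp f" "\<And>x. \<bar>f x\<bar> \<le> c" and T: "T \<ge> 0"
    and bdd: "bdd_above (range (\<lambda>x. \<Sum>y\<in>nb x - {x}. q x y))"
  shows "rev_poincare f T x \<le> c\<^sup>2"
proof -
  obtain K where K: "\<And>x. (\<Sum>y\<in>nb x - {x}. q x y) \<le> K"
    using bdd by (auto simp: bdd_above_def)
  have K0: "K \<ge> 0" using order_trans[OF sum_nonneg K[of x]] by simp
  have "rev_poincare f s y \<le> T * (K * (2 * c)\<^sup>2) + c\<^sup>2" if s: "s \<in> {0..T}" for s y
  proof -
    have u: "\<bar>heat q s f y\<bar> \<le> c" for y
      using heat_abs_le[of s f c y] f(2) s by simp
    have "2 * Gamma q (heat q s f) y = (\<Sum>z\<in>nb y. q y z * (heat q s f z - heat q s f y)\<^sup>2)"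
      by (simp add: Gamma_eq)
    also have "\<dots> = (\<Sum>z\<in>nb y - {y}. q y z * (heat q s f z - heat q s f y)\<^sup>2)"
      by (intro sum.mono_neutral_right) auto
    also have "\<dots> \<le> (\<Sum>z\<in>nb y - {y}. q y z * (2 * c)\<^sup>2)"
    proof (intro sum_mono mult_left_mono)
      fix z
      have "\<bar>heat q s f z - heat q s f y\<bar> \<le> 2 * c" using u[of y] u[of z] by linarith
      from power_mono[OF this, of 2] show "(heat q s f z - heat q s f y)\<^sup>2 \<le> (2 * c)\<^sup>2" by simp
    qed simp
    also have "\<dots> \<le> K * (2 * c)\<^sup>2"
      unfolding sum_distrib_right[symmetric] by (intro mult_right_mono K) auto
    finally have "s * (2 * Gamma q (heat q s f) y) \<le> T * (K * (2 * c)\<^sup>2)"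
      using s T K0 by (intro mult_mono[of s T]) auto
    moreover have "(heat q s f y)\<^sup>2 \<le> c\<^sup>2"
      using power_mono[OF u[of y], of 2] by simp
    ultimately show ?thesis by (simp add: rev_poincare_def mult_ac)
  qed
  note M = this
  define M where "M = T * (K * (2 * c)\<^sup>2) + c\<^sup>2"
  have M0: "M \<ge> 0" using T K0 by (simp add: M_def)
  show ?thesis
  proof (rule rev_poincare_bound_of_jump_bound[OF CD conn f T])
    fix s A y assume s: "s \<in> {0..T}" and A: "finite (A :: 'v set)"
    have "(\<Sum>z\<in>A - {y}. q y z * rev_poincare f s z) \<le> (\<Sum>z\<in>A - {y}. q y z * M)"
      unfolding M_def by (intro sum_mono mult_left_mono M s) auto
    also have "\<dots> = (\<Sum>z\<in>(A - {y}) \<inter> nb y. q y z * M)"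
      using A by (intro sum.mono_neutral_right) (auto simp: less_le)
    also have "\<dots> \<le> (\<Sum>z\<in>nb y - {y}. q y z * M)"
      using A M0 by (intro sum_mono2) auto
    also have "\<dots> \<le> K * M"
      unfolding sum_distrib_right[symmetric] by (intro mult_right_mono K M0)
    finally show "(\<Sum>z\<in>A - {y}. q y z * rev_poincare f s z) \<le> K * M" .
  qed
qed

text \<open>A single term of the weighted sum of \<open>H\<close> is at most \<open>C\<close>; as
  the measure is bounded below, \<open>H\<close> is bounded by \<open>M\<close>. The error of the
  given cutoffs is then \<open>2 * C * M / k\<close>.\<close>

lemma rev_poincare_bound_B:
  assumes CD: "CD0inf q"
    and f: "fin_supp f" "\<And>x. \<bar>f x\<bar> \<le> c" and T: "T \<ge> 0"
    and m0: "Inf (range m) > 0"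
    and \<eta>: "\<And>k. k \<ge> 1 \<Longrightarrow> fin_supp (\<eta> k)" "\<And>k x. k \<ge> 1 \<Longrightarrow> Gamma q (\<eta> k) x \<le> 1 / real k"
      "\<And>x. (\<lambda>k. \<eta> k x) \<longlonglongrightarrow> 1"
  shows "rev_poincare f T x \<le> c\<^sup>2"
proof (rule rev_poincare_le[OF CD f(2) T])
  fix \<epsilon> :: real assume \<epsilon>: "\<epsilon> > 0"
  obtain C where C: "\<And>s A. s \<in> {0..T} \<Longrightarrow> finite A \<Longrightarrow> (\<Sum>x\<in>A. m x * rev_poincare f s x) \<le> C"
    using rev_poincare_l1_bound[OF f(1), of T] by blast
  have C0: "C \<ge> 0" using C[of 0 "{}"] T by auto
  define M where "M = C / Inf (range m)"
  have M: "rev_poincare f s y \<le> M" if s: "s \<in> {0..T}" for s y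
  proof -
    have "Inf (range m) \<le> m y"
      by (intro cInf_lower bdd_belowI[of _ 0]) auto
    then have "Inf (range m) * rev_poincare f s y \<le> m y * rev_poincare f s y"
      using s by (intro mult_right_mono rev_poincare_nonneg) auto
    also have "\<dots> \<le> C" using C[OF s, of "{y}"] by simp
    finally show ?thesis using m0 by (simp add: M_def field_simps)
  qed
  have M0: "M \<ge> 0" using C0 m0 by (simp add: M_def)
  have "(\<lambda>k. 2 * C * M * (1 / real k)) \<longlonglongrightarrow> 2 * C * M * 0"
    by (intro tendsto_mult tendsto_const lim_1_over_n)
  then have "eventually (\<lambda>k. 2 * C * M * (1 / real k) < \<epsilon>) sequentially"
    using \<epsilon> by (intro order_tendstoD(2)) auto
  moreover have "eventually (\<lambda>k. 1/2 < \<eta> k x) sequentially"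
    using \<eta>(3) by (rule order_tendstoD(1)) simp
  ultimately have "eventually (\<lambda>k. 2 * C * M * (1 / real k) < \<epsilon> \<and> 1/2 < \<eta> k x \<and> k \<ge> 1) sequentially"
    using eventually_ge_at_top[of 1] by eventually_elim auto
  then obtain k where k: "2 * C * M * (1 / real k) < \<epsilon>" "1/2 < \<eta> k x" "k \<ge> 1"
    by (auto dest: eventually_happens)
  show "\<exists>\<eta>. fin_supp \<eta> \<and> 1/2 \<le> \<eta> x \<and> (\<forall>s\<in>{0..T}. \<forall>B. finite B \<longrightarrow>
    (\<Sum>y\<in>B. \<Sum>z\<in>B. m y * q y z * (rev_poincare f s y * rev_poincare f s z * (\<eta> y - \<eta> z)\<^sup>2)) \<le> \<epsilon>)"
  proof (intro exI[of _ "\<eta> k"] conjI ballI allI impI \<eta>(1) k(3) less_imp_le[OF k(2)])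
    fix s B assume s: "s \<in> {0..T}" and B: "finite (B :: 'v set)"
    show "(\<Sum>y\<in>B. \<Sum>z\<in>B. m y * q y z * (rev_poincare f s y * rev_poincare f s z * (\<eta> k y - \<eta> k z)\<^sup>2)) \<le> \<epsilon>"
      by (rule order_trans[OF sum_sum_cutoff_Gamma less_imp_le[OF k(1)]])
        (use s C B M \<eta>(2) k(3) in \<open>auto intro: rev_poincare_nonneg\<close>)
  qed
qed

text \<open>Since \<open>q y z \<le> m z\<close>, the jump sum is dominated by the weighted sum of
  \<open>H\<close>.\<close>

lemma rev_poincare_bound_C:
  assumes CD: "CD0inf q" and conn: "connected_graph q"
    and f: "fin_supp f" "\<And>x. \<bar>f x\<bar> \<le> c" and T: "T \<ge> 0"
    and qm: "\<And>x y. q x y \<le> m y"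
  shows "rev_poincare f T x \<le> c\<^sup>2"
proof -
  obtain C where C: "\<And>s A. s \<in> {0..T} \<Longrightarrow> finite A \<Longrightarrow> (\<Sum>x\<in>A. m x * rev_poincare f s x) \<le> C"
    using rev_poincare_l1_bound[OF f(1), of T] by blast
  show ?thesis
  proof (rule rev_poincare_bound_of_jump_bound[OF CD conn f T])
    fix s A y assume s: "s \<in> {0..T}" and A: "finite (A :: 'v set)"
    have "(\<Sum>z\<in>A - {y}. q y z * rev_poincare f s z) \<le> (\<Sum>z\<in>A - {y}. m z * rev_poincare f s z)"
      using s by (intro sum_mono mult_right_mono qm rev_poincare_nonneg) auto
    also have "\<dots> \<le> C" using A by (intro C s) auto
    finally show "(\<Sum>z\<in>A - {y}. q y z * rev_poincare f s z) \<le> C" .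
  qed
qed

section \<open>Gradient bounds\<close>

lemma q_min_le: "q x y > 0 \<Longrightarrow> q_min q \<le> q x y"
  unfolding q_min_def by (rule cInf_lower) (auto intro!: bdd_belowI[of _ 0])

lemma q_min_nonneg: "q x y > 0 \<Longrightarrow> q_min q \<ge> 0"
  unfolding q_min_def by (rule cInf_greatest) auto

text \<open>Keep one edge in \<open>2 * t * Gamma\<close> and bound its rate below by the infimum.
  The product form also covers \<open>q_min q = 0\<close>, where a quotient would be
  infinite.\<close>

lemma heat_gradient_edge:
  assumes P: "\<And>x. rev_poincare f t x \<le> c\<^sup>2" and t: "t \<ge> 0" and c: "c \<ge> 0" and y: "y \<in> nb x"
  shows "\<bar>heat q t f x - heat q t f y\<bar> * sqrt (t * q_min q) \<le> c"
proof -
  let ?u = "heat q t f"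
  have qm: "0 \<le> q_min q" "q_min q \<le> q x y"
    using y q_min_nonneg q_min_le by auto
  have "(\<bar>?u x - ?u y\<bar> * sqrt (t * q_min q))\<^sup>2 = t * (q_min q * (?u y - ?u x)\<^sup>2)"
    using t qm by (simp add: power_mult_distrib power2_commute)
  also have "\<dots> \<le> t * (q x y * (?u y - ?u x)\<^sup>2)"
    using t qm by (intro mult_left_mono mult_right_mono) auto
  also have "\<dots> \<le> t * (\<Sum>z\<in>nb x. q x z * (?u z - ?u x)\<^sup>2)"
    using y t member_le_sum[of y "nb x" "\<lambda>z. q x z * (?u z - ?u x)\<^sup>2"]
    by (intro mult_left_mono) auto
  also have "\<dots> = t * (2 * Gamma q ?u x)" by (simp add: Gamma_eq)
  also have "\<dots> \<le> rev_poincare f t x"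
    by (simp add: rev_poincare_def)
  also have "\<dots> \<le> c\<^sup>2" by (rule P)
  finally show ?thesis using c by (rule power2_le_imp_le)
qed

text \<open>Telescoping along a walk turns the edge estimate into a Lipschitz bound for the graph
  distance.\<close>

lemma path_increment_bound:
  assumes edge: "\<And>x y. y \<in> nb x \<Longrightarrow> \<bar>u x - u y\<bar> * r \<le> c" and r: "r \<ge> 0"
  shows "(x, y) \<in> adj q ^^ n \<Longrightarrow> \<bar>u x - u y\<bar> * r \<le> real n * c"
proof (induction n arbitrary: y)
  case (Suc n)
  then obtain z where z: "(x, z) \<in> adj q ^^ n" "y \<in> nb z" by (auto simp: adj_def)
  have "\<bar>u x - u y\<bar> * r \<le> (\<bar>u x - u z\<bar> + \<bar>u z - u y\<bar>) * r"
    using r by (intro mult_right_mono) auto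
  then show ?case
    using Suc.IH[OF z(1)] edge[OF z(2)] by (simp add: algebra_simps)
qed simp

section \<open>From finitely supported to bounded functions\<close>

lemma heat_diff:
  assumes t: "t \<ge> 0" and f: "\<And>x. \<bar>f x\<bar> \<le> c" and g: "\<And>x. \<bar>g x\<bar> \<le> c"
  shows "heat q t (\<lambda>x. f x - g x) x = heat q t f x - heat q t g x"
proof (rule heat_eqI)
  have "((\<lambda>S. heat_fin q S t f x - heat_fin q S t g x) \<longlongrightarrow> heat q t f x - heat q t g x) (finite_subsets_at_top UNIV)"
    by (intro tendsto_diff heat_tendsto[OF t f] heat_tendsto[OF t g])
  then show "((\<lambda>S. heat_fin q S t (\<lambda>x. f x - g x) x) \<longlongrightarrow> heat q t f x - heat q t g x) (finite_subsets_at_top UNIV)"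
    by (rule Lim_transform_eventually) (intro eventually_finite_subsets_at_top_weakI, simp add: heat_fin_diff)
qed

text \<open>A sandwich: the Dirichlet semigroup on \<open>K\<close> sees only the values of
  \<open>f\<close> on \<open>K\<close>, so it lies below the heat flow of the truncation, which in
  turn lies below that of \<open>f\<close>. The lower bound converges to the upper one.\<close>

lemma heat_truncate_tendsto_nonneg:
  assumes t: "t \<ge> 0" and f: "\<And>x. f x \<ge> 0" "\<And>x. f x \<le> c"
  shows "((\<lambda>K. heat q t (\<lambda>z. f z * indicator K z) x) \<longlongrightarrow> heat q t f x) (finite_subsets_at_top UNIV)"
proof (rule real_tendsto_sandwich[OF _ _ _ tendsto_const])
  have f': "\<bar>f x\<bar> \<le> c" for x using f[of x] by simp
  have fK: "\<bar>f z * indicator K z\<bar> \<le> c" for z K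
    using f[of z] by (auto simp: indicator_def intro: order_trans)
  show "((\<lambda>K. heat_fin q K t f x) \<longlongrightarrow> heat q t f x) (finite_subsets_at_top UNIV)"
    by (rule heat_tendsto[OF t f'])
  show "\<forall>\<^sub>F K in finite_subsets_at_top UNIV. heat_fin q K t f x \<le> heat q t (\<lambda>z. f z * indicator K z) x"
  proof (rule eventually_finite_subsets_at_top_weakI)
    fix K :: "'v set" assume K: "finite K"
    show "heat_fin q K t f x \<le> heat q t (\<lambda>z. f z * indicator K z) x"
    proof (rule tendsto_lowerbound[OF heat_tendsto[OF t fK]])
      have "heat_fin q K t f x \<le> heat_fin q S t (\<lambda>z. f z * indicator K z) x" if "finite S \<and> K \<subseteq> S" for S
      proof -
        have "heat_fin q K t f x = heat_fin q K t (\<lambda>z. f z * indicator K z) x"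
          by (rule heat_fin_cong) simp
        also have "\<dots> \<le> heat_fin q S t (\<lambda>z. f z * indicator K z) x"
          using that t f by (intro heat_fin_mono) auto
        finally show ?thesis .
      qed
      then show "\<forall>\<^sub>F S in finite_subsets_at_top UNIV. heat_fin q K t f x \<le> heat_fin q S t (\<lambda>z. f z * indicator K z) x"
        by (rule eventually_mono[OF eventually_mem_finite_subsets[OF K]])
    qed simp
  qed
  show "\<forall>\<^sub>F K in finite_subsets_at_top UNIV. heat q t (\<lambda>z. f z * indicator K z) x \<le> heat q t f x"
  proof (rule always_eventually, rule allI)
    fix K :: "'v set"
    show "heat q t (\<lambda>z. f z * indicator K z) x \<le> heat q t f x"
    proof (rule tendsto_le[OF _ heat_tendsto[OF t f'] heat_tendsto[OF t fK]])
      show "\<forall>\<^sub>F S in finite_subsets_at_top UNIV. heat_fin q S t (\<lambda>z. f z * indicator K z) x \<le> heat_fin q S t f x"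
        using t f by (intro eventually_finite_subsets_at_top_weakI heat_fin_mono_fun) (auto simp: indicator_def)
    qed simp
  qed
qed

lemma heat_truncate_tendsto:
  assumes t: "t \<ge> 0" and f: "\<And>x. \<bar>f x\<bar> \<le> c"
  shows "((\<lambda>K. heat q t (\<lambda>z. f z * indicator K z) x) \<longlongrightarrow> heat q t f x) (finite_subsets_at_top UNIV)"
proof -
  define g h where "g z = max 0 (f z)" and "h z = max 0 (- f z)" for z
  have gh: "0 \<le> g z" "g z \<le> c" "0 \<le> h z" "h z \<le> c" "f z = g z - h z" for z
    using f[of z] by (auto simp: g_def h_def)
  have c: "\<bar>g z\<bar> \<le> c" "\<bar>h z\<bar> \<le> c" "\<bar>g z * indicator K z\<bar> \<le> c" "\<bar>h z * indicator K z\<bar> \<le> c" for z K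
    using gh[of z] by (auto simp: indicator_def)
  have "heat q t (\<lambda>z. f z * indicator K z) x = heat q t (\<lambda>z. g z * indicator K z) x - heat q t (\<lambda>z. h z * indicator K z) x" for K
    using heat_diff[OF t c(3)[of _ K] c(4)[of _ K], where x = x] by (simp add: gh(5) left_diff_distrib)
  moreover have "heat q t f x = heat q t g x - heat q t h x"
    using heat_diff[where f = g and g = h and c = c and x = x, OF t c(1) c(2)] by (simp add: gh(5)[symmetric])
  moreover have "((\<lambda>K. heat q t (\<lambda>z. g z * indicator K z) x - heat q t (\<lambda>z. h z * indicator K z) x) \<longlongrightarrow>
      heat q t g x - heat q t h x) (finite_subsets_at_top UNIV)"
    using t gh by (intro tendsto_diff heat_truncate_tendsto_nonneg[where c = c]) auto
  ultimately show ?thesis by simp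
qed

text \<open>Truncations are finitely supported and keep the bound \<open>c\<close>, so the estimate
  holds for each of them with the same constant and passes to the limit at the two vertices.\<close>

lemma heat_gradient_bound:
  assumes conn: "connected_graph q"
    and P: "\<And>f x. fin_supp f \<Longrightarrow> (\<And>x. \<bar>f x\<bar> \<le> c) \<Longrightarrow> rev_poincare f t x \<le> c\<^sup>2"
    and t: "t \<ge> 0" and f: "\<And>x. \<bar>f x\<bar> \<le> c" and xy: "x \<noteq> y"
  shows "\<bar>grad q (heat q t f) x y\<bar> * sqrt (t * q_min q) \<le> c"
proof -
  define d where "d = graph_dist q x y"
  have path: "(x, y) \<in> adj q ^^ d" unfolding d_def by (rule graph_dist_relpow[OF conn])
  have d: "d > 0" using path xy by (cases d) auto
  \<comment> \<open>The first edge of a path shows that the set of positive rates is nonempty, so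
    its infimum is nonnegative and the square root is genuine.\<close>
  then obtain n where "d = Suc n" by (cases d) auto
  then obtain z where "(x, z) \<in> adj q" using path relpow_Suc_D2[of x y n "adj q"] by blast
  then have r: "sqrt (t * q_min q) \<ge> 0" using q_min_nonneg[of x z] t by (simp add: adj_def)
  have c: "c \<ge> 0" using f[of x] by linarith
  have "\<bar>heat q t f x - heat q t f y\<bar> * sqrt (t * q_min q) \<le> real d * c"
  proof (rule tendsto_upperbound)
    show "((\<lambda>K. \<bar>heat q t (\<lambda>z. f z * indicator K z) x - heat q t (\<lambda>z. f z * indicator K z) y\<bar> * sqrt (t * q_min q))
      \<longlongrightarrow> \<bar>heat q t f x - heat q t f y\<bar> * sqrt (t * q_min q)) (finite_subsets_at_top UNIV)"
      by (intro tendsto_intros heat_truncate_tendsto[OF t f])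
    show "\<forall>\<^sub>F K in finite_subsets_at_top UNIV.
      \<bar>heat q t (\<lambda>z. f z * indicator K z) x - heat q t (\<lambda>z. f z * indicator K z) y\<bar> * sqrt (t * q_min q) \<le> real d * c"
    proof (rule eventually_finite_subsets_at_top_weakI)
      fix K :: "'v set" assume "finite K"
      then have "fin_supp (\<lambda>z. f z * indicator K z)"
        unfolding fin_supp_def by (rule rev_finite_subset) (auto simp: indicator_def)
      moreover have "\<bar>f z * indicator K z\<bar> \<le> c" for z
        using f[of z] c by (auto simp: indicator_def)
      ultimately show "\<bar>heat q t (\<lambda>z. f z * indicator K z) x - heat q t (\<lambda>z. f z * indicator K z) y\<bar> * sqrt (t * q_min q) \<le> real d * c"
        by (intro path_increment_bound[OF _ r path] heat_gradient_edge P t c) auto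
    qed
  qed simp
  then have "\<bar>heat q t f x - heat q t f y\<bar> * sqrt (t * q_min q) / real d \<le> c"
    using d by (simp add: divide_le_eq mult.commute)
  then show ?thesis by (simp add: grad_def d_def)
qed

end

lemma abs_le_sup_norm: "bounded_fun f \<Longrightarrow> \<bar>f x\<bar> \<le> sup_norm f"
  unfolding bounded_fun_def sup_norm_def by (rule cSup_upper) auto

theorem mainTheorem18:
  fixes q :: "'v::countable \<Rightarrow> 'v \<Rightarrow> real" and m :: "'v \<Rightarrow> real"
  assumes graph: "is_graph q"
    and rev: "reversible q m"
    and conn: "connected_graph q"
    and CD: "CD0inf q"
    and cond: "bdd_above (range (\<lambda>x. \<Sum>y\<in>{y. q x y > 0} - {x}. q x y))
      \<or> (Inf (range m) > 0 \<and>
         (\<exists>\<eta> :: nat \<Rightarrow> 'v \<Rightarrow> real.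
            (\<forall>k\<ge>1. fin_supp (\<eta> k)) \<and>
            (\<forall>k\<ge>1. \<forall>x. Gamma q (\<eta> k) x \<le> 1 / real k) \<and>
            (\<forall>k\<ge>1. \<forall>x. \<eta> k x \<le> 1) \<and>
            (\<forall>x. (\<lambda>k. \<eta> k x) \<longlonglongrightarrow> 1)))
      \<or> (\<forall>x y. q x y \<le> m y)"
  shows "(\<forall>f :: 'v \<Rightarrow> real. (\<forall>x. f x \<ge> 0) \<and> fin_supp f \<longrightarrow>
            (\<forall>t>0. \<forall>x y. x \<noteq> y \<longrightarrow>
               \<bar>grad q (heat q t f) x y\<bar> * sqrt (t * q_min q) \<le> sup_norm f))
       \<and> ((bdd_above (range (\<lambda>x. \<Sum>y\<in>{y. q x y > 0} - {x}. q x y))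
           \<or> (Inf (range m) > 0 \<and>
              (\<exists>\<eta> :: nat \<Rightarrow> 'v \<Rightarrow> real.
                 (\<forall>k\<ge>1. fin_supp (\<eta> k)) \<and>
                 (\<forall>k\<ge>1. \<forall>x. Gamma q (\<eta> k) x \<le> 1 / real k) \<and>
                 (\<forall>k\<ge>1. \<forall>x. \<eta> k x \<le> 1) \<and>
                 (\<forall>x. (\<lambda>k. \<eta> k x) \<longlonglongrightarrow> 1))))
          \<longrightarrow> (\<forall>f :: 'v \<Rightarrow> real. bounded_fun f \<longrightarrow>
                (\<forall>t>0. \<forall>x y. x \<noteq> y \<longrightarrow>
                   \<bar>grad q (heat q t f) x y\<bar> * sqrt (t * q_min q) \<le> sup_norm f)))"
proof -
  interpret reversible_graph q m by unfold_locales (fact graph rev)+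
  have P: "rev_poincare f t x \<le> c\<^sup>2"
    if f: "fin_supp f" "\<And>x. \<bar>f x\<bar> \<le> c" and t: "t \<ge> 0" for f c t x
    using cond
  proof (elim disjE conjE exE)
    assume "bdd_above (range (\<lambda>x. \<Sum>y\<in>{y. q x y > 0} - {x}. q x y))"
    then show ?thesis by (rule rev_poincare_bound_A[OF CD conn f t])
  next
    fix \<eta> :: "nat \<Rightarrow> 'v \<Rightarrow> real"
    assume "Inf (range m) > 0" "\<forall>k\<ge>1. fin_supp (\<eta> k)"
      "\<forall>k\<ge>1. \<forall>x. Gamma q (\<eta> k) x \<le> 1 / real k" "\<forall>x. (\<lambda>k. \<eta> k x) \<longlonglongrightarrow> 1"
    then show ?thesis by (intro rev_poincare_bound_B[OF CD f t, of \<eta>]) auto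
  next
    assume "\<forall>x y. q x y \<le> m y"
    then show ?thesis by (intro rev_poincare_bound_C[OF CD conn f t]) auto
  qed
  \<comment> \<open>The constant is \<open>c = sup_norm f\<close>, which bounds the absolute values
    of \<open>f\<close> as soon as \<open>f\<close> is bounded, in particular for finite
    support.\<close>
  have bound: "\<bar>grad q (heat q t f) x y\<bar> * sqrt (t * q_min q) \<le> sup_norm f"
    if "bounded_fun f" "t > 0" "x \<noteq> y" for f t x y
    using that abs_le_sup_norm by (intro heat_gradient_bound[OF conn] P) auto
  moreover have "bounded_fun f" if "fin_supp f" for f :: "'v \<Rightarrow> real"
    using fin_supp_bounded[OF that] by (auto simp: bounded_fun_def bdd_above_def)
  ultimately show ?thesis by blast
qed

end
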